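(* Let $B_1\subset\mathbb{R}^2$ be the open disk of radius $1$ centered at the origin. The following hold. (i) There exists a sequence $\{u_n\}_n\subset C^\infty_c(B_1)$ of incompressible vector fields such that, denoting $\omega_n:=\operatorname{curl} u_n$, it holds $$\|u_n\|_{L^2}\rightarrow 0\qquad \text{ and } \qquad |\omega_n|\overset{*}{\rightharpoonup} \Omega \ \text{ with } \ \Omega(\{0\})>0.$$ (ii) There exists a sequence $\{u_n\}_n\subset C^\infty_c(B_1)$ of incompressible vector fields such that $\|u_n\|_{L^2}=1$ for all $n$ and, denoting $\omega_n:=\operatorname{curl} u_n$, it holds $$\|u_n\|_{L^1}+ \|\omega_n\|_{L^1}\rightarrow 0 \qquad \text{ and }\qquad |u_n|^2\overset{*}{\rightharpoonup} \Lambda \ \text{ with } \ \Lambda(\{0\})>0.$$ Being compactly supported, the sequences $\{u_n\}_n$ in (i) and (ii) work as examples on $\mathbb{T}^2$ as well.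
   Context: "Incompressible" means divergence-free; $\operatorname{curl}v=\partial_1v_2-\partial_2v_1$. The weak* convergences are as $n\to\infty$ in the space $\mathcal M(B_1)$ of finite Borel measures. $\mathbb{T}^2$ is a two-dimensional flat torus; fields compactly supported in $B_1$ are regarded as fields on a torus whose fundamental domain contains $B_1$. *)

theory Defs
  imports "HOL-Analysis.Analysis"
begin

section \<open>Smooth planar vector fields\<close>

text \<open>Fields are total maps on the plane; a field in \<open>C\<^sub>c\<^sup>\<infinity>(U)\<close> is identified with its
  extension by zero.\<close>

primrec C_k :: "nat \<Rightarrow> ('a::euclidean_space \<Rightarrow> 'b::real_normed_vector) \<Rightarrow> bool" where
  "C_k 0 f \<longleftrightarrow> continuous_on UNIV f"
| "C_k (Suc k) f \<longleftrightarrow> (\<forall>x. f differentiable (at x)) \<and>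
     (\<forall>v. C_k k (\<lambda>x. frechet_derivative f (at x) v))"

definition smooth :: "('a::euclidean_space \<Rightarrow> 'b::real_normed_vector) \<Rightarrow> bool" where
  "smooth f \<longleftrightarrow> (\<forall>k. C_k k f)"

definition support :: "('a::topological_space \<Rightarrow> 'b::zero) \<Rightarrow> 'a set" where
  "support f = closure {x. f x \<noteq> 0}"

definition Cc_smooth :: "'a set \<Rightarrow> ('a::euclidean_space \<Rightarrow> 'b::real_normed_vector) set" where
  "Cc_smooth U = {f. smooth f \<and> compact (support f) \<and> support f \<subseteq> U}"

definition partial_deriv :: "2 \<Rightarrow> (real^2 \<Rightarrow> real) \<Rightarrow> real^2 \<Rightarrow> real" where
  "partial_deriv i f x = frechet_derivative f (at x) (axis i 1)"

definition incompressible :: "(real^2 \<Rightarrow> real^2) \<Rightarrow> bool" where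
  "incompressible v \<longleftrightarrow>
     (\<forall>x. partial_deriv 1 (\<lambda>y. v y $ 1) x + partial_deriv 2 (\<lambda>y. v y $ 2) x = 0)"

definition curl :: "(real^2 \<Rightarrow> real^2) \<Rightarrow> real^2 \<Rightarrow> real" where
  "curl v x = partial_deriv 1 (\<lambda>y. v y $ 2) x - partial_deriv 2 (\<lambda>y. v y $ 1) x"

definition Lp_norm :: "real \<Rightarrow> (real^2) set \<Rightarrow> (real^2 \<Rightarrow> 'b::real_normed_vector) \<Rightarrow> real" where
  "Lp_norm p X f = (LINT x:X|lborel. norm (f x) powr p) powr (1 / p)"


section \<open>Weak* convergence of measures\<close>

text \<open>Only nonnegative measures occur: weak* limits of nonnegative measures are nonnegative.\<close>

definition finite_borel_measures :: "(real^2) set \<Rightarrow> (real^2) measure set" where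
  "finite_borel_measures X =
     {\<mu>. finite_measure \<mu> \<and> sets \<mu> = sets (restrict_space borel X)}"

definition density_on :: "(real^2) set \<Rightarrow> (real^2 \<Rightarrow> real) \<Rightarrow> (real^2) measure" where
  "density_on X f = density (restrict_space lborel X) (\<lambda>x. ennreal (f x))"

text \<open>\<open>T\<close> is the predual, given as a set of functions on the plane of which only the values
  on \<open>X\<close> matter.\<close>

definition weak_star_conv ::
  "(real^2) set \<Rightarrow> (real^2 \<Rightarrow> real) set \<Rightarrow> (nat \<Rightarrow> (real^2) measure) \<Rightarrow> (real^2) measure \<Rightarrow> bool" where
  "weak_star_conv X T \<mu> \<nu> \<longleftrightarrow>
     (\<forall>n. \<mu> n \<in> finite_borel_measures X) \<and> \<nu> \<in> finite_borel_measures X \<and>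
     (\<forall>\<phi>\<in>T. (\<lambda>n. \<integral>x. \<phi> x \<partial>\<mu> n) \<longlonglongrightarrow> (\<integral>x. \<phi> x \<partial>\<nu>))"

text \<open>\<open>C\<^sub>0(U)\<close>, whose dual is the space of finite Borel measures on an open set \<open>U\<close>.\<close>

definition C_0 :: "(real^2) set \<Rightarrow> (real^2 \<Rightarrow> real) set" where
  "C_0 U = {\<phi>. continuous_on U \<phi> \<and>
     (\<forall>\<epsilon>>0. \<exists>K. compact K \<and> K \<subseteq> U \<and> (\<forall>x\<in>U - K. \<bar>\<phi> x\<bar> < \<epsilon>))}"


section \<open>Flat tori\<close>

text \<open>A flat torus is \<open>\<real>\<^sup>2/\<Lambda>\<close> for a lattice \<open>\<Lambda>\<close> of rank two. Functions on it are \<open>\<Lambda>\<close>-periodic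
  functions on the plane; the projection restricts to a Borel isomorphism from a fundamental
  domain, so measures on the torus are represented as measures on a fundamental domain.\<close>

definition lattice :: "(real^2) set \<Rightarrow> bool" where
  "lattice \<Lambda> \<longleftrightarrow> (\<exists>a b. a \<noteq> b \<and> independent {a, b} \<and>
     \<Lambda> = {of_int m *\<^sub>R a + of_int k *\<^sub>R b | m k. True})"

definition fundamental_domain :: "(real^2) set \<Rightarrow> (real^2) set \<Rightarrow> bool" where
  "fundamental_domain \<Lambda> D \<longleftrightarrow> D \<in> sets borel \<and> (\<forall>x. \<exists>!y. y \<in> D \<and> y - x \<in> \<Lambda>)"

definition periodic :: "(real^2) set \<Rightarrow> (real^2 \<Rightarrow> 'b) \<Rightarrow> bool" where
  "periodic \<Lambda> f \<longleftrightarrow> (\<forall>x. \<forall>l\<in>\<Lambda>. f (x + l) = f x)"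

definition C_torus :: "(real^2) set \<Rightarrow> (real^2 \<Rightarrow> real) set" where
  "C_torus \<Lambda> = {\<phi>. continuous_on UNIV \<phi> \<and> periodic \<Lambda> \<phi>}"

text \<open>The \<open>\<Lambda>\<close>-periodic function that agrees with \<open>f\<close> on \<open>D\<close>.\<close>

definition periodize :: "(real^2) set \<Rightarrow> (real^2) set \<Rightarrow> (real^2 \<Rightarrow> 'b) \<Rightarrow> real^2 \<Rightarrow> 'b" where
  "periodize \<Lambda> D f x = f (THE y. y \<in> D \<and> y - x \<in> \<Lambda>)"

end

theory Submission
  imports Defs "HOL-Real_Asymp.Real_Asymp"
begin

text \<open>For \<open>g \<in> C\<^sub>c\<^sup>\<infinity>(0,\<infinity>)\<close> put \<open>u(x) = g(t) x\<^sup>\<bottom> / |x|\<^sup>2\<close>, where \<open>t = - ln |x|\<^sup>2\<close>. This circular flow is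
  incompressible with vorticity \<open>- 2 g'(t) / |x|\<^sup>2\<close>, and since \<open>x \<mapsto> t\<close> maps Lebesgue measure on the
  plane to \<open>\<pi> e\<^sup>-\<^sup>t dt\<close>, we get \<open>\<parallel>u\<parallel>\<^sub>2\<^sup>2 = \<pi> \<integral> g\<^sup>2\<close>, \<open>\<parallel>curl u\<parallel>\<^sub>1 = 2\<pi> \<integral> |g'|\<close> and
  \<open>\<parallel>u\<parallel>\<^sub>1 = \<pi> \<integral> |g| e\<^sup>-\<^sup>t\<^sup>/\<^sup>2\<close>. Moving the support of \<open>g\<close> to infinity concentrates \<open>u\<close> at the origin. For a fixed
  bump \<open>\<phi>\<close> supported in \<open>[0,1]\<close>, squeezing, \<open>g(t) = \<phi>(N(t - N))\<close>, preserves \<open>\<integral> |g'|\<close> and sends \<open>\<integral> g\<^sup>2\<close> to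
  \<open>0\<close>, which gives (i); stretching, \<open>g(t) = c \<phi>(t/N - 1)\<close> with \<open>c\<close> of order \<open>N\<^sup>-\<^sup>1\<^sup>/\<^sup>2\<close>, preserves
  \<open>\<integral> g\<^sup>2\<close> and sends \<open>\<integral> |g'|\<close> to \<open>0\<close>, which gives (ii).\<close>


section \<open>Closure properties of smooth maps\<close>

text \<open>\<open>frechet_derivative\<close> is a choice operator; uniqueness of derivatives lets
  any explicit \<open>f'\<close> stand in for it when the recursion of \<open>C_k\<close> is
  unfolded.\<close>

lemma C_k_SucI:
  assumes "\<And>x. (f has_derivative f' x) (at x)" and "\<And>v. C_k k (\<lambda>x. f' x v)"
  shows "C_k (Suc k) f"
proof -
  have "frechet_derivative f (at x) = f' x" for x
    using frechet_derivative_at[OF assms(1)] by simp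
  then show ?thesis using assms by (auto simp: differentiable_def)
qed

lemma C_k_Suc_has_derivative:
  "C_k (Suc k) f \<Longrightarrow> (f has_derivative frechet_derivative f (at x)) (at x)"
  by (simp add: frechet_derivative_works)

lemma C_k_SucD: "C_k (Suc k) f \<Longrightarrow> C_k k f"
proof (induction k arbitrary: f)
  case 0
  then show ?case
    by (auto intro!: continuous_at_imp_continuous_on differentiable_imp_continuous_within)
next
  case (Suc k)
  then show ?case by auto
qed

lemma C_k_const: "C_k k (\<lambda>x. c)"
  by (induction k arbitrary: c) (auto intro!: C_k_SucI[where f' = "\<lambda>_ _. 0"] simp del: C_k.simps(2))

lemma C_k_linear:
  assumes "bounded_linear f" shows "C_k k f"
proof (cases k)
  case 0
  then show ?thesis using assms by (simp add: linear_continuous_on)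
next
  case (Suc m)
  show ?thesis unfolding Suc
    by (rule C_k_SucI[where f' = "\<lambda>_. f"])
      (use assms in \<open>auto intro: bounded_linear_imp_has_derivative C_k_const\<close>)
qed

lemma C_k_add: "C_k k f \<Longrightarrow> C_k k g \<Longrightarrow> C_k k (\<lambda>x. f x + g x)"
proof (induction k arbitrary: f g)
  case 0
  then show ?case by (auto intro: continuous_intros)
next
  case (Suc k)
  show ?case
    by (rule C_k_SucI)
      (use Suc in \<open>auto intro!: has_derivative_add C_k_Suc_has_derivative simp del: C_k.simps(2)\<close>,
       use Suc in auto)
qed

text \<open>The Leibniz rule pairs each derivative with an undifferentiated factor, so the induction
  also needs \<open>C_k_SucD\<close>. One argument covers products, scalings and inner
  products.\<close>

lemma C_k_bilinear:
  assumes "bounded_bilinear b"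
  shows "C_k k f \<Longrightarrow> C_k k g \<Longrightarrow> C_k k (\<lambda>x. b (f x) (g x))"
proof (induction k arbitrary: f g)
  case 0
  then show ?case using bounded_bilinear.continuous_on[OF assms] by auto
next
  case (Suc k)
  show ?case
  proof (rule C_k_SucI)
    show "((\<lambda>x. b (f x) (g x)) has_derivative
        (\<lambda>v. b (f x) (frechet_derivative g (at x) v) + b (frechet_derivative f (at x) v) (g x))) (at x)" for x
      by (intro bounded_bilinear.FDERIV[OF assms] C_k_Suc_has_derivative[OF Suc.prems(1)]
          C_k_Suc_has_derivative[OF Suc.prems(2)])
    show "C_k k (\<lambda>x. b (f x) (frechet_derivative g (at x) v)
        + b (frechet_derivative f (at x) v) (g x))" for v
      using Suc C_k_SucD[OF Suc.prems(1)] C_k_SucD[OF Suc.prems(2)]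
      by (intro C_k_add Suc.IH) auto
  qed
qed

lemmas C_k_mult = C_k_bilinear[OF bounded_bilinear_mult]
lemmas C_k_scaleR = C_k_bilinear[OF bounded_bilinear_scaleR]

lemma C_k_Suc_real:
  fixes f :: "real \<Rightarrow> real"
  assumes "\<And>x. (f has_real_derivative f' x) (at x)" and "C_k k f'"
  shows "C_k (Suc k) f"
  by (rule C_k_SucI[where f' = "\<lambda>x v. f' x * v"])
    (use assms C_k_mult[OF assms(2) C_k_const] in \<open>auto simp: has_field_derivative_def\<close>)

lemma C_k_Suc_realD:
  fixes f :: "real \<Rightarrow> real"
  assumes "C_k (Suc k) f"
  shows "(f has_real_derivative deriv f x) (at x)" and "C_k k (deriv f)"
proof -
  show D: "(f has_real_derivative deriv f x) (at x)" for x
    using assms by (auto simp: DERIV_deriv_iff_real_differentiable)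
  have "frechet_derivative f (at x) 1 = deriv f x" for x
    using frechet_derivative_at[OF D[unfolded has_field_derivative_def], of x]
    by (metis mult.right_neutral)
  then have "deriv f = (\<lambda>x. frechet_derivative f (at x) 1)" by auto
  then show "C_k k (deriv f)" using assms by auto
qed

text \<open>By the chain rule each directional derivative has the factor
  \<open>deriv f (g x)\<close>; the induction varies \<open>f\<close>, so it applies to
  \<open>deriv f\<close> as well.\<close>

lemma C_k_compose_real:
  fixes f :: "real \<Rightarrow> real"
  shows "C_k k f \<Longrightarrow> C_k k g \<Longrightarrow> C_k k (\<lambda>x. f (g x))"
proof (induction k arbitrary: f g)
  case 0
  then show ?case by (auto intro: continuous_on_compose2)
next
  case (Suc k)
  note D = C_k_Suc_realD[OF Suc.prems(1)]
  show ?case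
  proof (rule C_k_SucI)
    show "((\<lambda>x. f (g x)) has_derivative
        (\<lambda>v. deriv f (g x) * frechet_derivative g (at x) v)) (at x)" for x
      using has_derivative_compose[OF C_k_Suc_has_derivative[OF Suc.prems(2), of x]
          D(1)[of "g x", unfolded has_field_derivative_def]] .
    show "C_k k (\<lambda>x. deriv f (g x) * frechet_derivative g (at x) v)" for v
      using C_k_mult[OF Suc.IH[OF D(2) C_k_SucD[OF Suc.prems(2)]]] Suc.prems(2) by simp
  qed
qed

lemma smooth_real_deriv:
  fixes g :: "real \<Rightarrow> real"
  assumes "smooth g"
  shows "(g has_real_derivative deriv g x) (at x)" and "smooth (deriv g)"
  using assms C_k_Suc_realD unfolding smooth_def by blast+

lemma smooth_continuous: "smooth f \<Longrightarrow> continuous_on UNIV f"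
  unfolding smooth_def by (metis C_k.simps(1))


section \<open>A bump function\<close>

text \<open>The case \<open>m = 0\<close> is the classical flat function; the powers in the
  denominator make the linear span of the family closed under differentiation.\<close>

definition exp_inv_div :: "nat \<Rightarrow> real \<Rightarrow> real" where
  "exp_inv_div m t = (if t > 0 then exp (- 1 / t) / t ^ m else 0)"

lemma exp_inv_div_tendsto_0: "(exp_inv_div m \<longlongrightarrow> 0) (at 0)"
proof -
  have "((\<lambda>t::real. exp (- 1 / t) / t ^ m) \<longlongrightarrow> 0) (at_right 0)"
    by real_asymp
  then have "(exp_inv_div m \<longlongrightarrow> 0) (at_right 0)"
    by (rule Lim_transform_eventually)
      (auto simp: exp_inv_div_def eventually_at_filter)
  moreover have "(exp_inv_div m \<longlongrightarrow> 0) (at_left 0)"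
    by (rule Lim_transform_eventually[OF tendsto_const])
      (auto simp: exp_inv_div_def eventually_at_filter)
  ultimately show ?thesis by (simp add: filterlim_split_at)
qed

lemma exp_inv_div_has_derivative:
  "(exp_inv_div m has_real_derivative exp_inv_div (m + 2) t - m * exp_inv_div (m + 1) t) (at t)"
proof -
  consider "t < 0" | "t = 0" | "t > 0" by linarith
  then show ?thesis
  proof cases
    case 1
    have "((\<lambda>_. 0) has_real_derivative 0) (at t)" by simp
    then have "(exp_inv_div m has_real_derivative 0) (at t)"
      by (rule has_field_derivative_transform_within_open[where S = "{..<0}"])
        (use 1 in \<open>auto simp: exp_inv_div_def\<close>)
    then show ?thesis using 1 by (simp add: exp_inv_div_def)
  next
    case 2
    \<comment> \<open>At 0 the difference quotient is itself the next member of the family, which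
      tends to 0.\<close>
    have "(\<lambda>h. (exp_inv_div m (0 + h) - exp_inv_div m 0) / h) = exp_inv_div (Suc m)"
      by (auto simp: exp_inv_div_def fun_eq_iff)
    then have "(exp_inv_div m has_real_derivative 0) (at 0)"
      unfolding DERIV_def using exp_inv_div_tendsto_0[of "Suc m"] by simp
    then show ?thesis using 2 by (simp add: exp_inv_div_def)
  next
    case 3
    have "real m * t ^ (m - Suc 0) = real m * t ^ m / t"
      using 3 by (cases m) auto
    then have "((\<lambda>t. t ^ m) has_real_derivative real m * t ^ m / t) (at t)"
      using DERIV_pow[of m t UNIV] by simp
    moreover have "((\<lambda>t. exp (- 1 / t)) has_real_derivative exp (- 1 / t) / t\<^sup>2) (at t)"
      using 3 by (auto intro!: derivative_eq_intros simp: power2_eq_square)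
    ultimately have "((\<lambda>t. exp (- 1 / t) / t ^ m) has_real_derivative
        (exp (- 1 / t) / t\<^sup>2 * t ^ m - exp (- 1 / t) * (real m * t ^ m / t)) / (t ^ m * t ^ m)) (at t)"
      using 3 by (intro DERIV_divide) auto
    also have "(exp (- 1 / t) / t\<^sup>2 * t ^ m - exp (- 1 / t) * (real m * t ^ m / t)) / (t ^ m * t ^ m)
        = exp_inv_div (m + 2) t - real m * exp_inv_div (m + 1) t"
      using 3 by (simp add: exp_inv_div_def divide_simps power_add power2_eq_square algebra_simps)
    finally have "((\<lambda>t. exp (- 1 / t) / t ^ m) has_real_derivative
        exp_inv_div (m + 2) t - m * exp_inv_div (m + 1) t) (at t)" .
    then show ?thesis
      by (rule has_field_derivative_transform_within_open[where S = "{0<..}"])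
        (use 3 in \<open>auto simp: exp_inv_div_def\<close>)
  qed
qed

lemma C_k_exp_inv_div: "C_k k (exp_inv_div m)"
proof (induction k arbitrary: m)
  case 0
  then show ?case
    using exp_inv_div_has_derivative
    by (auto intro!: continuous_at_imp_continuous_on DERIV_isCont)
next
  case (Suc k)
  have "C_k k (\<lambda>t. exp_inv_div (m + 2) t + - real m * exp_inv_div (m + 1) t)"
    by (intro C_k_add C_k_mult C_k_const Suc)
  then show ?case
    by (intro C_k_Suc_real[OF exp_inv_div_has_derivative]) simp
qed

definition bump :: "real \<Rightarrow> real" where
  "bump t = exp_inv_div 0 t * exp_inv_div 0 (1 - t)"

lemma bump_eq_0_iff: "bump t = 0 \<longleftrightarrow> t \<notin> {0<..<1}"
  by (auto simp: bump_def exp_inv_div_def)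

lemma smooth_bump: "smooth bump"
proof -
  have "C_k k (\<lambda>t. 1 + - t :: real)" for k
    by (intro C_k_add C_k_const C_k_linear bounded_linear_minus bounded_linear_ident)
  from C_k_mult[OF C_k_exp_inv_div C_k_compose_real[OF C_k_exp_inv_div this]]
  have "C_k k (\<lambda>t. exp_inv_div 0 t * exp_inv_div 0 (1 + - t))" for k .
  then show ?thesis by (simp add: smooth_def bump_def[abs_def])
qed

section \<open>Radial vortices in logarithmic coordinates\<close>

text \<open>The substitution \<open>t = - ln s\<close>; for \<open>g\<close> vanishing near \<open>+\<infinity>\<close> the result vanishes near
  \<open>s = 0\<close>.\<close>

definition log_pull :: "nat \<Rightarrow> (real \<Rightarrow> real) \<Rightarrow> real \<Rightarrow> real" where
  "log_pull m g s = (if s > 0 then g (- ln s) / s ^ m else 0)"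

text \<open>Large \<open>t\<close> corresponds to small \<open>s\<close>. The half-line
  \<open>s < exp (- b)\<close> contains 0 and all negative \<open>s\<close>, so no singularity
  survives at the origin.\<close>

lemma log_pull_locally_0:
  assumes "\<And>t. t > b \<Longrightarrow> g t = 0" and "s < exp (- b)"
  shows "log_pull m g s = 0"
proof (cases "s > 0")
  case True
  then have "ln s < ln (exp (- b))"
    using assms(2) by (subst ln_less_cancel_iff) auto
  then show ?thesis using assms(1)[of "- ln s"] by (simp add: log_pull_def)
qed (simp add: log_pull_def)

text \<open>For \<open>s > 0\<close> this is the quotient rule with dt/ds = -1/s; elsewhere
  \<open>log_pull m g\<close> is locally zero. Differentiation stays inside the family, at the price
  of a larger \<open>m\<close> and a profile involving \<open>g'\<close>.\<close>

lemma log_pull_has_derivative: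
  assumes "\<And>t. (g has_real_derivative g' t) (at t)" and "\<And>t. t > b \<Longrightarrow> g t = 0"
  shows "(log_pull m g has_real_derivative
           log_pull (Suc m) (\<lambda>t. - g' t - real m * g t) s) (at s)"
proof (cases "s > 0")
  case True
  have "real m * s ^ (m - Suc 0) = real m * s ^ m / s"
    using True by (cases m) auto
  then have "((\<lambda>s. s ^ m) has_real_derivative real m * s ^ m / s) (at s)"
    using DERIV_pow[of m s UNIV] by simp
  moreover have "((\<lambda>s. g (- ln s)) has_real_derivative g' (- ln s) * (- 1 / s)) (at s)"
    using True by (intro DERIV_chain2[OF assms(1)]) (auto intro!: derivative_eq_intros)
  ultimately have "((\<lambda>s. g (- ln s) / s ^ m) has_real_derivative
      (g' (- ln s) * (- 1 / s) * s ^ m - g (- ln s) * (real m * s ^ m / s)) / (s ^ m * s ^ m)) (at s)"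
    using True by (intro DERIV_divide) auto
  also have "(g' (- ln s) * (- 1 / s) * s ^ m - g (- ln s) * (real m * s ^ m / s)) / (s ^ m * s ^ m)
      = log_pull (Suc m) (\<lambda>t. - g' t - real m * g t) s"
    using True by (simp add: log_pull_def divide_simps algebra_simps)
  finally show ?thesis
    by (rule has_field_derivative_transform_within_open[where S = "{0<..}"])
      (use True in \<open>auto simp: log_pull_def\<close>)
next
  case False
  have "((\<lambda>_. 0) has_real_derivative 0) (at s)" by simp
  then have "(log_pull m g has_real_derivative 0) (at s)"
    by (rule has_field_derivative_transform_within_open[where S = "{..<exp (- b)}"])
      (use False log_pull_locally_0[of b g, OF assms(2)] le_less_trans[OF _ exp_gt_zero, of s "- b"]
        in auto)
  then show ?thesis using False by (simp add: log_pull_def)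
qed

lemma deriv_eq_0_greater:
  fixes g :: "real \<Rightarrow> real"
  assumes "\<And>t. t > b \<Longrightarrow> g t = 0" "t > b" shows "deriv g t = 0"
proof -
  have "((\<lambda>_. 0) has_real_derivative 0) (at t)" by simp
  then have "(g has_real_derivative 0) (at t)"
    by (rule has_field_derivative_transform_within_open[where S = "{b<..}"]) (use assms in auto)
  then show ?thesis by (rule DERIV_imp_deriv)
qed

lemma deriv_eq_0_less:
  fixes g :: "real \<Rightarrow> real"
  assumes "\<And>t. t < a \<Longrightarrow> g t = 0" "t < a" shows "deriv g t = 0"
proof -
  have "((\<lambda>_. 0) has_real_derivative 0) (at t)" by simp
  then have "(g has_real_derivative 0) (at t)"
    by (rule has_field_derivative_transform_within_open[where S = "{..<a}"]) (use assms in auto)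
  then show ?thesis by (rule DERIV_imp_deriv)
qed

text \<open>Each derivative passes to a new profile involving \<open>deriv g\<close>. The base case
  gets continuity from differentiability, whence the extra order required of
  \<open>g\<close>.\<close>

lemma C_k_log_pull:
  assumes "C_k (Suc k) g" and "\<And>t. t > b \<Longrightarrow> g t = 0"
  shows "C_k k (log_pull m g)"
  using assms
proof (induction k arbitrary: g m)
  case 0
  show ?case
    using log_pull_has_derivative[OF C_k_Suc_realD(1)[OF 0(1)] 0(2)]
    by (auto intro!: continuous_at_imp_continuous_on DERIV_isCont simp: C_k.simps(1))
next
  case (Suc k)
  note D = C_k_Suc_realD[OF Suc.prems(1)]
  have "C_k (Suc k) (\<lambda>t. (- 1) * deriv g t + (- real m) * g t)"
    by (intro C_k_add C_k_mult C_k_const D C_k_SucD[OF Suc.prems(1)])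
  moreover have "(- 1) * deriv g t + (- real m) * g t = 0" if "t > b" for t
    using that Suc.prems(2) deriv_eq_0_greater[of b g t] by simp
  ultimately have "C_k k (log_pull (Suc m) (\<lambda>t. (- 1) * deriv g t + (- real m) * g t))"
    by (rule Suc.IH)
  then show ?case
    by (intro C_k_Suc_real[OF log_pull_has_derivative[OF D(1) Suc.prems(2)]]) simp_all
qed

lemma log_pull_eq_0:
  assumes "\<And>t. t < a \<Longrightarrow> g t = 0" and "s > exp (- a)"
  shows "log_pull m g s = 0"
proof -
  have "s > 0" using assms(2) less_trans[OF exp_gt_zero] by blast
  then have "ln (exp (- a)) < ln s"
    using assms(2) by (subst ln_less_cancel_iff) auto
  then show ?thesis using assms(1)[of "- ln s"] by (simp add: log_pull_def)
qed

section \<open>Circular vortex fields: smoothness, incompressibility, vorticity and support\<close>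

definition rot :: "real^2 \<Rightarrow> real^2" where
  "rot x = (\<chi> i. if i = 1 then - x $ 2 else x $ 1)"

lemma rot_nth [simp]: "rot x $ 1 = - x $ 2" "rot x $ 2 = x $ 1"
  by (simp_all add: rot_def)

lemma norm_rot [simp]: "norm (rot x) = norm x"
  by (simp add: norm_vec_def L2_set_def sum_2 add.commute)

lemma bounded_linear_rot: "bounded_linear rot"
  by (auto intro!: linear_conv_bounded_linear[THEN iffD1] linearI simp: vec_eq_iff forall_2)

text \<open>The profile takes the squared norm, a polynomial, so that smoothness at the origin
  reduces to that of \<open>log_pull 1 g\<close> on the real line.\<close>

definition vortex :: "(real \<Rightarrow> real) \<Rightarrow> real^2 \<Rightarrow> real^2" where
  "vortex g x = log_pull 1 g ((norm x)\<^sup>2) *\<^sub>R rot x"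

lemma smooth_vortex:
  assumes "smooth g" and "\<And>t. t > b \<Longrightarrow> g t = 0"
  shows "smooth (vortex g)"
  unfolding smooth_def
proof
  fix k
  have "C_k k (log_pull 1 g)"
    using C_k_log_pull assms unfolding smooth_def by blast
  moreover have "C_k k (\<lambda>x :: real^2. x \<bullet> x)"
    by (intro C_k_bilinear[OF bounded_bilinear_inner] C_k_linear bounded_linear_ident)
  ultimately have "C_k k (\<lambda>x :: real^2. log_pull 1 g (x \<bullet> x))"
    by (rule C_k_compose_real)
  from C_k_scaleR[OF this C_k_linear[OF bounded_linear_rot]]
  show "C_k k (vortex g)"
    by (simp add: vortex_def[abs_def] power2_norm_eq_inner)
qed

text \<open>\<open>f'\<close> is the derivative of \<open>f\<close>, so both formulas are the
  product rule for \<open>f\<close> of the squared norm times a coordinate; \<open>axis i 1\<close>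
  records the derivative of that coordinate for both \<open>i\<close> at once.\<close>

lemma partial_deriv_vortex:
  assumes "smooth g" and "\<And>t. t > b \<Longrightarrow> g t = 0"
  defines "f \<equiv> log_pull 1 g" and "f' \<equiv> log_pull 2 (\<lambda>t. - deriv g t - g t)"
  shows "partial_deriv i (\<lambda>y. vortex g y $ 1) x
           = - (2 * f' ((norm x)\<^sup>2) * x $ i * x $ 2 + f ((norm x)\<^sup>2) * (axis i 1 :: real^2) $ 2)"
    and "partial_deriv i (\<lambda>y. vortex g y $ 2) x
           = 2 * f' ((norm x)\<^sup>2) * x $ i * x $ 1 + f ((norm x)\<^sup>2) * (axis i 1 :: real^2) $ 1"
proof -
  have "(f has_real_derivative f' s) (at s)" for s
    using log_pull_has_derivative[OF smooth_real_deriv(1)[OF assms(1)] assms(2), where m = 1 and s = s]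
    by (simp add: f_def f'_def numeral_2_eq_2)
  then have "(f has_derivative (\<lambda>v. f' (x \<bullet> x) * v)) (at (x \<bullet> x))"
    by (simp add: has_field_derivative_def)
  moreover have "((\<lambda>y. y \<bullet> y) has_derivative (\<lambda>v. 2 * (x \<bullet> v))) (at x)"
    by (auto intro!: derivative_eq_intros simp: inner_commute)
  ultimately have F: "((\<lambda>y. f (y \<bullet> y)) has_derivative (\<lambda>v. f' (x \<bullet> x) * (2 * (x \<bullet> v)))) (at x)"
    by (rule has_derivative_compose[rotated])
  have n: "((\<lambda>y :: real^2. y $ j) has_derivative (\<lambda>v. v $ j)) (at x)" for j
    by (intro bounded_linear_imp_has_derivative bounded_linear_vec_nth)
  have "((\<lambda>y. vortex g y $ 1) has_derivative
      (\<lambda>v. - (f (x \<bullet> x) * v $ 2 + f' (x \<bullet> x) * (2 * (x \<bullet> v)) * x $ 2))) (at x)"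
    using has_derivative_minus[OF has_derivative_mult[OF F n[of 2]]]
    by (simp add: vortex_def f_def power2_norm_eq_inner)
  from frechet_derivative_at[OF this, symmetric]
  show "partial_deriv i (\<lambda>y. vortex g y $ 1) x
      = - (2 * f' ((norm x)\<^sup>2) * x $ i * x $ 2 + f ((norm x)\<^sup>2) * (axis i 1 :: real^2) $ 2)"
    by (simp add: partial_deriv_def power2_norm_eq_inner inner_axis)
  have "((\<lambda>y. vortex g y $ 2) has_derivative
      (\<lambda>v. f (x \<bullet> x) * v $ 1 + f' (x \<bullet> x) * (2 * (x \<bullet> v)) * x $ 1)) (at x)"
    using has_derivative_mult[OF F n[of 1]]
    by (simp add: vortex_def f_def power2_norm_eq_inner)
  from frechet_derivative_at[OF this, symmetric]
  show "partial_deriv i (\<lambda>y. vortex g y $ 2) x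
      = 2 * f' ((norm x)\<^sup>2) * x $ i * x $ 1 + f ((norm x)\<^sup>2) * (axis i 1 :: real^2) $ 1"
    by (simp add: partial_deriv_def power2_norm_eq_inner inner_axis)
qed

text \<open>In \<open>partial_deriv_vortex\<close> the terms with \<open>f'\<close> cancel between
  the two diagonal partial derivatives, and those with \<open>f\<close> drop out since
  \<open>rot\<close> has zero diagonal.\<close>

lemma incompressible_vortex:
  assumes "smooth g" and "\<And>t. t > b \<Longrightarrow> g t = 0"
  shows "incompressible (vortex g)"
  using partial_deriv_vortex[OF assms] by (simp add: incompressible_def axis_def)

text \<open>In the notation of \<open>partial_deriv_vortex\<close>, the curl is twice the sum of
  \<open>f\<close> and the squared norm times \<open>f'\<close>. Multiplying by the squared norm
  turns the \<open>- g\<close> inside \<open>f'\<close> into exactly \<open>- f\<close>, so only the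
  derivative of the profile remains.\<close>

lemma curl_vortex:
  assumes "smooth g" and "\<And>t. t > b \<Longrightarrow> g t = 0"
  shows "curl (vortex g) x = - 2 * log_pull 1 (deriv g) ((norm x)\<^sup>2)"
proof -
  have *: "(norm x)\<^sup>2 = x $ 1 * x $ 1 + x $ 2 * x $ 2"
    by (simp add: power2_norm_eq_inner inner_vec_def sum_2)
  have "curl (vortex g) x = 2 * log_pull 2 (\<lambda>t. - deriv g t - g t) ((norm x)\<^sup>2) * (norm x)\<^sup>2
      + 2 * log_pull 1 g ((norm x)\<^sup>2)"
    by (simp add: curl_def partial_deriv_vortex[OF assms] axis_def, simp add: * algebra_simps)
  also have "\<dots> = - 2 * log_pull 1 (deriv g) ((norm x)\<^sup>2)"
    \<comment> \<open>At the origin both sides are 0 by the default value of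
      \<open>log_pull\<close>.\<close>
    by (cases "x = 0") (auto simp: log_pull_def field_simps power2_eq_square)
  finally show ?thesis .
qed

lemma vortex_eq_0:
  assumes "\<And>t. t < a \<Longrightarrow> g t = 0" and "norm x > exp (- a / 2)"
  shows "vortex g x = 0"
proof -
  have "exp (- a) = (exp (- a / 2))\<^sup>2"
    by (simp add: power2_eq_square flip: exp_add)
  also have "\<dots> < (norm x)\<^sup>2"
    using assms(2) by (intro power_strict_mono) auto
  finally show ?thesis using log_pull_eq_0[OF assms(1)] by (simp add: vortex_def)
qed

text \<open>Vanishing for \<open>t < a\<close> confines the support to the closed disk of radius
  \<open>exp (- a / 2)\<close>, the half coming from the squared norm; \<open>a > 0\<close> makes
  this radius less than 1.\<close>

lemma vortex_in_Cc_smooth: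
  assumes "smooth g" and "\<And>t. t > b \<Longrightarrow> g t = 0" and "\<And>t. t < a \<Longrightarrow> g t = 0" and "a > 0"
  shows "vortex g \<in> Cc_smooth (ball 0 1)"
proof -
  have *: "support (vortex g) \<subseteq> cball 0 (exp (- a / 2))"
    unfolding support_def using vortex_eq_0[OF assms(3)]
    by (intro closure_minimal) (force simp: not_less)+
  then have "compact (support (vortex g))"
    by (auto simp: support_def intro!: bounded_subset[OF bounded_cball]
        simp: compact_eq_bounded_closed)
  moreover have "cball 0 (exp (- a / 2)) \<subseteq> ball (0 :: real^2) 1"
    using assms(4) le_less_trans[of _ "exp (- a / 2)" 1] by auto
  ultimately show ?thesis
    using * smooth_vortex[OF assms(1,2)] by (auto simp: Cc_smooth_def)
qed

text \<open>Partial derivatives of the components are components of the full derivative in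
  coordinate directions, and these are continuous by \<open>C_k\<close> at order 1.\<close>

lemma continuous_curl:
  assumes "smooth u"
  shows "continuous_on UNIV (curl u)"
proof -
  have d: "(u has_derivative frechet_derivative u (at x)) (at x)"
    and c: "continuous_on UNIV (\<lambda>x. frechet_derivative u (at x) v)" for x v
    using assms unfolding smooth_def
    by (metis C_k_Suc_has_derivative, metis C_k.simps)
  have "partial_deriv i (\<lambda>y. u y $ j) x = frechet_derivative u (at x) (axis i 1) $ j" for i j x
    using frechet_derivative_at[OF bounded_linear.has_derivative[OF bounded_linear_vec_nth d]]
    by (metis partial_deriv_def)
  then have "curl u = (\<lambda>x. frechet_derivative u (at x) (axis 1 1) $ 2
      - frechet_derivative u (at x) (axis 2 1) $ 1)"
    by (auto simp: curl_def)
  then show ?thesis by (auto intro!: continuous_intros c)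
qed


section \<open>Integrals of radial functions\<close>

text \<open>Measures that are finite and equal on all open right half-lines coincide. Up to the
  origin, the preimage of \<open>{a<..}\<close> is the disk of radius \<open>exp (- a / 2)\<close>,
  whose area is also the integral of the density over \<open>{a<..}\<close>.\<close>

lemma distr_neg_ln_norm:
  "distr lborel borel (\<lambda>x :: real^2. - ln ((norm x)\<^sup>2))
     = density lborel (\<lambda>t. ennreal (pi * exp (- t)))" (is "?M = ?N")
proof (rule measure_eqI_lessThan)
  have N: "emeasure ?N {a<..} = ennreal (pi * exp (- a))" for a
  proof -
    have "emeasure ?N {a<..} = (\<integral>\<^sup>+t. ennreal (pi * exp (- t)) * indicator {a<..} t \<partial>lborel)"
      by (simp add: emeasure_density)
    also have "\<dots> = (\<integral>\<^sup>+t. ennreal (pi * exp (- t)) * indicator {a..} t \<partial>lborel)"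
      by (intro nn_integral_cong_AE eventually_mono[OF AE_lborel_singleton[of a]])
        (auto simp: indicator_def)
    also have "\<dots> = ennreal (0 - (- pi * exp (- a)))"
    proof (rule nn_integral_FTC_atLeast)
      show "((\<lambda>t. - pi * exp (- t)) \<longlongrightarrow> 0) at_top" by real_asymp
    qed (auto intro!: derivative_eq_intros)
    finally show ?thesis by simp
  qed
  have M: "emeasure ?M {a<..} = ennreal (pi * exp (- a))" for a
  proof -
    \<comment> \<open>The origin is set aside because \<open>ln\<close> has only a default value at
      0; it is a null set below.\<close>
    have *: "a < - ln ((norm x)\<^sup>2) \<longleftrightarrow> x \<in> ball 0 (exp (- a / 2))" if "x \<noteq> 0" for x :: "real^2"
    proof -
      have "a < - ln ((norm x)\<^sup>2) \<longleftrightarrow> ln (norm x) < - a / 2"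
        using that by (auto simp: ln_realpow)
      also have "\<dots> \<longleftrightarrow> norm x < exp (- a / 2)"
        using that by (metis exp_less_cancel_iff exp_ln zero_less_norm_iff)
      finally show ?thesis by simp
    qed
    have "emeasure ?M {a<..} = emeasure lborel ((\<lambda>x :: real^2. - ln ((norm x)\<^sup>2)) -` {a<..})"
      by (subst emeasure_distr) auto
    also have "\<dots> = emeasure lborel (ball (0 :: real^2) (exp (- a / 2)))"
    proof (rule emeasure_eq_AE)
      show "AE x :: real^2 in lborel. x \<in> (\<lambda>x. - ln ((norm x)\<^sup>2)) -` {a<..}
          \<longleftrightarrow> x \<in> ball 0 (exp (- a / 2))"
        by (rule eventually_mono[OF AE_lborel_singleton[of 0]]) (simp only: vimage_eq greaterThan_iff * not_False_eq_True)
      have "(\<lambda>x :: real^2. - ln ((norm x)\<^sup>2)) \<in> borel_measurable borel" by measurable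
      from measurable_sets[OF this, of "{a<..}"]
      show "(\<lambda>x :: real^2. - ln ((norm x)\<^sup>2)) -` {a<..} \<in> sets lborel" by simp
    qed auto
    also have "\<dots> = ennreal (pi * exp (- a))"
      by (subst emeasure_ball) (auto simp: unit_ball_vol_2 power2_eq_square simp flip: exp_add)
    finally show ?thesis .
  qed
  show "emeasure ?M {a<..} < \<infinity>" "emeasure ?M {a<..} = emeasure ?N {a<..}" for a
    using M N by simp_all
qed simp_all

text \<open>The factor \<open>exp (- t)\<close> is the Jacobian from
  \<open>distr_neg_ln_norm\<close>; the origin is exempt because a point is null.\<close>

lemma integral_log_radial:
  fixes k :: "real \<Rightarrow> real" and h :: "real^2 \<Rightarrow> real"
  assumes [measurable]: "k \<in> borel_measurable borel" "h \<in> borel_measurable borel"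
    and "\<And>x. x \<noteq> 0 \<Longrightarrow> h x = k (- ln ((norm x)\<^sup>2))"
  shows "(\<integral>x. h x \<partial>lborel) = pi * (\<integral>t. exp (- t) * k t \<partial>lborel)"
proof -
  have "(\<integral>x. h x \<partial>lborel) = (\<integral>x. k (- ln ((norm x)\<^sup>2)) \<partial>(lborel :: (real^2) measure))"
    by (rule integral_cong_AE)
      (use assms(3) in \<open>auto intro: eventually_mono[OF AE_lborel_singleton[of 0]]\<close>)
  also have "\<dots> = (\<integral>t. k t \<partial>distr lborel borel (\<lambda>x :: real^2. - ln ((norm x)\<^sup>2)))"
    by (subst integral_distr) auto
  also have "\<dots> = (\<integral>t. pi * (exp (- t) * k t) \<partial>lborel)"
    unfolding distr_neg_ln_norm by (subst integral_density) (auto simp: mult_ac)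
  finally show ?thesis by simp
qed

text \<open>With t = - ln |x|^2 the factor 1/|x| becomes exp (t/2), so the speed is a function of t
  alone, ready for \<open>integral_log_radial\<close>.\<close>

lemma norm_vortex:
  assumes "x \<noteq> 0"
  shows "norm (vortex g x) = \<bar>g (- ln ((norm x)\<^sup>2))\<bar> * exp (- ln ((norm x)\<^sup>2) / 2)"
proof -
  have "exp (- ln ((norm x)\<^sup>2) / 2) = inverse (norm x)"
    using assms by (simp add: ln_realpow exp_minus)
  then show ?thesis
    using assms by (simp add: vortex_def log_pull_def field_simps power2_eq_square)
qed

section \<open>Norms of a vortex as one-dimensional integrals\<close>

context
  fixes g :: "real \<Rightarrow> real" and b :: real
  assumes g: "smooth g" "\<And>t. t > b \<Longrightarrow> g t = 0"
begin

lemma measurable_smooth [measurable]: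
  "g \<in> borel_measurable borel" "deriv g \<in> borel_measurable borel" "vortex g \<in> borel_measurable borel"
  "curl (vortex g) \<in> borel_measurable borel"
  using smooth_continuous[OF g(1)] smooth_continuous[OF smooth_real_deriv(2)[OF g(1)]]
    smooth_continuous[OF smooth_vortex[OF g]] continuous_curl[OF smooth_vortex[OF g]]
  by (auto intro: borel_measurable_continuous_onI)

text \<open>The squared speed carries \<open>exp t\<close>, which cancels the Jacobian; the energy
  is therefore invariant under translation of \<open>g\<close>.\<close>

lemma integral_norm_vortex_sq:
  "(\<integral>x. (norm (vortex g x))\<^sup>2 \<partial>lborel) = pi * (\<integral>t. (g t)\<^sup>2 \<partial>lborel)"
proof -
  have "(\<integral>x. (norm (vortex g x))\<^sup>2 \<partial>lborel) = pi * (\<integral>t. exp (- t) * ((g t)\<^sup>2 * exp t) \<partial>lborel)"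
    by (rule integral_log_radial)
      (auto simp: norm_vortex power_mult_distrib simp flip: exp_double)
  then show ?thesis by (simp add: exp_minus field_simps)
qed

text \<open>Only half of the Jacobian is cancelled; the remaining weight damps this norm as the
  support of \<open>g\<close> moves to the right.\<close>

lemma integral_norm_vortex:
  "(\<integral>x. norm (vortex g x) \<partial>lborel) = pi * (\<integral>t. \<bar>g t\<bar> * exp (- t / 2) \<partial>lborel)"
proof -
  have "(\<integral>x. norm (vortex g x) \<partial>lborel) = pi * (\<integral>t. exp (- t) * (\<bar>g t\<bar> * exp (t / 2)) \<partial>lborel)"
    by (rule integral_log_radial) (auto simp: norm_vortex)
  also have "(\<lambda>t. exp (- t) * (\<bar>g t\<bar> * exp (t / 2))) = (\<lambda>t. \<bar>g t\<bar> * exp (- t / 2))"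
    by (auto simp: mult.left_commute simp flip: exp_add)
  finally show ?thesis .
qed

text \<open>Vorticity carries 1/|x|^2 = exp t, cancelling the Jacobian and leaving the total
  variation of \<open>g\<close>, which is invariant under translation and dilation.\<close>

lemma integral_abs_curl_vortex:
  "(\<integral>x. \<bar>curl (vortex g) x\<bar> \<partial>lborel) = 2 * pi * (\<integral>t. \<bar>deriv g t\<bar> \<partial>lborel)"
proof -
  have "(\<integral>x. \<bar>curl (vortex g) x\<bar> \<partial>lborel) = pi * (\<integral>t. exp (- t) * (2 * \<bar>deriv g t\<bar> * exp t) \<partial>lborel)"
    by (rule integral_log_radial)
      (auto simp: curl_vortex[OF g] log_pull_def abs_mult exp_minus field_simps)
  then show ?thesis by (simp add: exp_minus field_simps)
qed

end


section \<open>Concentration at the origin\<close>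

text \<open>The Dirac mass of weight \<open>c\<close> at the origin, pushed to the trace
  sigma-algebra on \<open>X\<close> as \<open>finite_borel_measures X\<close> demands.\<close>

definition point_mass :: "(real^2) set \<Rightarrow> real \<Rightarrow> (real^2) measure" where
  "point_mass X c = distr (point_measure {0} (\<lambda>_. ennreal c)) (restrict_space borel X) (\<lambda>x. x)"

lemma
  assumes "0 \<in> X" and "c \<ge> 0"
  shows point_mass_finite: "point_mass X c \<in> finite_borel_measures X"
    and integral_point_mass: "continuous_on X \<phi> \<Longrightarrow> (\<integral>x. \<phi> x \<partial>point_mass X c) = c * \<phi> 0"
    and measure_point_mass: "measure (point_mass X c) {0} = c"
proof -
  let ?P = "point_measure {0 :: real^2} (\<lambda>_. ennreal c)" and ?R = "restrict_space borel X"
  have m: "(\<lambda>x. x) \<in> measurable ?P ?R"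
    using assms by (auto simp: measurable_def space_point_measure sets_point_measure space_restrict_space)
  have "finite_measure ?P"
    by (intro finite_measureI) (simp add: space_point_measure emeasure_point_measure_finite)
  then show "point_mass X c \<in> finite_borel_measures X"
    using finite_measure.finite_measure_distr[OF _ m]
    by (auto simp: finite_borel_measures_def point_mass_def)
  show "(\<integral>x. \<phi> x \<partial>point_mass X c) = c * \<phi> 0" if "continuous_on X \<phi>"
    unfolding point_mass_def using assms borel_measurable_continuous_on_restrict[OF that]
    by (subst integral_distr[OF m]) (auto simp: lebesgue_integral_point_measure_finite)
  have "{0} \<in> sets ?R"
    using assms by (auto simp: sets_restrict_space image_iff intro!: bexI[of _ "{0}"])
  then have "emeasure (point_mass X c) {0} = ennreal c"
    unfolding point_mass_def
    by (subst emeasure_distr[OF m]) (auto simp: space_point_measure emeasure_point_measure_finite)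
  then show "measure (point_mass X c) {0} = c"
    using assms by (simp add: measure_def)
qed

lemma density_on_finite:
  assumes "X \<in> sets borel" and "integrable lborel w" and "\<And>x. w x \<ge> 0"
  shows "density_on X w \<in> finite_borel_measures X"
proof -
  have [measurable]: "w \<in> borel_measurable borel" "X \<in> sets borel"
    using assms by auto
  have "emeasure (density_on X w) (space (density_on X w))
      = (\<integral>\<^sup>+x. ennreal (w x) \<partial>restrict_space lborel X)"
    unfolding density_on_def space_density
    by (subst emeasure_density) (auto intro!: nn_integral_cong measurable_restrict_space1
        simp: sets_restrict_space_iff)
  also have "\<dots> \<le> (\<integral>\<^sup>+x. ennreal (w x) \<partial>lborel)"
    by (subst nn_integral_restrict_space)
      (auto intro!: nn_integral_mono simp: indicator_def)
  also have "\<dots> < \<infinity>"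
    using assms by (simp add: nn_integral_eq_integral)
  finally show ?thesis
    by (auto simp: finite_borel_measures_def density_on_def sets_restrict_space intro!: finite_measureI)
qed

text \<open>The supports shrink to the origin, so in the limit a test function contributes only its
  value there. General \<open>X\<close> and \<open>T\<close> let one argument serve both the disk
  with \<open>C_0\<close> and a fundamental domain with \<open>C_torus\<close>.\<close>

lemma weak_star_conv_point_mass:
  fixes w :: "nat \<Rightarrow> real^2 \<Rightarrow> real"
  assumes X: "X \<in> sets borel" "ball 0 1 \<subseteq> X"
    and T: "\<And>\<phi>. \<phi> \<in> T \<Longrightarrow> continuous_on X \<phi>"
    and w: "\<And>n. continuous_on UNIV (w n)" "\<And>n x. w n x \<ge> 0"
      "\<And>n x. norm x > r n \<Longrightarrow> w n x = 0"
    and r: "r \<longlonglongrightarrow> 0" and c: "(\<lambda>n. \<integral>x. w n x \<partial>lborel) \<longlonglongrightarrow> c"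
  shows "weak_star_conv X T (\<lambda>n. density_on X (w n)) (point_mass X c)"
proof -
  have X0: "0 \<in> X" using X(2) by auto
  have c0: "c \<ge> 0" by (rule LIMSEQ_le_const[OF c]) (intro exI allI impI Bochner_Integration.integral_nonneg w)
  have int: "integrable lborel (w n)" for n
  proof -
    have "(\<lambda>x. indicator (cball 0 (r n)) x *\<^sub>R w n x) = w n"
      using w(3)[where n = n] by (force simp: indicator_def)
    moreover have "continuous_on (cball 0 (r n)) (w n)"
      using w(1) by (rule continuous_on_subset) simp
    ultimately show ?thesis
      using borel_integrable_compact[of "cball 0 (r n)" "w n"] by simp
  qed
  have int_mult: "integrable lborel (\<lambda>x. w n x * a)" for n a
    using int by simp
  have conv: "(\<lambda>n. \<integral>x. \<phi> x \<partial>density_on X (w n)) \<longlonglongrightarrow> c * \<phi> 0" if "\<phi> \<in> T" for \<phi>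
  proof -
    note cont = T[OF that]
    have [measurable]: "w n \<in> borel_measurable borel" for n using int[of n] by auto
    have I: "(\<integral>x. \<phi> x \<partial>density_on X (w n)) = (\<integral>x. w n x * (indicator X x * \<phi> x) \<partial>lborel)" for n
    proof -
      have "\<phi> \<in> borel_measurable (restrict_space lborel X)"
        using borel_measurable_continuous_on_restrict[OF cont]
        by (simp add: measurable_cong_sets[OF sets_restrict_space_cong[of lborel borel] refl])
      then have "(\<integral>x. \<phi> x \<partial>density_on X (w n)) = (\<integral>x. w n x * \<phi> x \<partial>restrict_space lborel X)"
        unfolding density_on_def using w(2)
        by (subst integral_density) (auto intro: measurable_restrict_space1)
      also have "\<dots> = (\<integral>x. w n x * (indicator X x * \<phi> x) \<partial>lborel)"
        using X(1) by (subst integral_restrict_space) (auto simp: mult_ac)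
      finally show ?thesis .
    qed
    have m: "(\<lambda>x. indicator X x * \<phi> x) \<in> borel_measurable borel"
      using borel_measurable_continuous_on_indicator[OF X(1) cont] by simp
    have "(\<lambda>n. (\<integral>x. w n x * (indicator X x * \<phi> x) \<partial>lborel) - (\<integral>x. w n x \<partial>lborel) * \<phi> 0) \<longlonglongrightarrow> 0"
    proof (rule LIMSEQ_I)
      fix e :: real assume "e > 0"
      \<comment> \<open>Eventually the mass is below \<open>c + 1\<close>, so an oscillation of
        \<open>\<phi>\<close> below \<open>d\<close> costs less than \<open>e\<close>; adding 1
        keeps the denominator positive when \<open>c = 0\<close>.\<close>
      define d where "d = e / (c + 1)"
      have d: "d > 0" "d * (c + 1) = e" using \<open>e > 0\<close> c0 by (auto simp: d_def)
      have "isCont \<phi> 0"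
        using cont X(2) by (metis centre_in_ball continuous_on_interior interior_maximal open_ball
            subsetD zero_less_one)
      then obtain \<delta> where \<delta>: "\<delta> > 0" "\<And>x. norm x < \<delta> \<Longrightarrow> \<bar>\<phi> x - \<phi> 0\<bar> < d"
        using d(1) unfolding continuous_at_eps_delta by (metis diff_zero dist_norm real_norm_def)
      \<comment> \<open>Radius below \<open>\<delta>\<close> controls \<open>\<phi>\<close>; radius
        below 1 keeps the support inside \<open>X\<close>.\<close>
      have "\<forall>\<^sub>F n in sequentially. r n < min \<delta> 1 \<and> (\<integral>x. w n x \<partial>lborel) < c + 1"
        using \<delta>(1) by (intro eventually_conj order_tendstoD(2)[OF r] order_tendstoD(2)[OF c]) auto
      then obtain N where N: "\<And>n. n \<ge> N \<Longrightarrow> r n < min \<delta> 1 \<and> (\<integral>x. w n x \<partial>lborel) < c + 1"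
        by (auto simp: eventually_sequentially)
      show "\<exists>N. \<forall>n\<ge>N. norm ((\<integral>x. w n x * (indicator X x * \<phi> x) \<partial>lborel)
          - (\<integral>x. w n x \<partial>lborel) * \<phi> 0 - 0) < e"
      proof (intro exI allI impI)
        fix n assume "n \<ge> N"
        note Nn = N[OF this]
        have bd: "\<bar>w n x * (indicator X x * \<phi> x) - w n x * \<phi> 0\<bar> \<le> w n x * d" for x
        proof (cases "norm x > r n")
          case False
          then have "x \<in> X" "norm x < \<delta>" using Nn X(2) by auto
          then have "w n x * (indicator X x * \<phi> x) - w n x * \<phi> 0 = w n x * (\<phi> x - \<phi> 0)"
            by (simp add: algebra_simps)
          then have "\<bar>w n x * (indicator X x * \<phi> x) - w n x * \<phi> 0\<bar> = w n x * \<bar>\<phi> x - \<phi> 0\<bar>"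
            using w(2)[of n x] by (simp only: abs_mult abs_of_nonneg)
          also have "\<dots> \<le> w n x * d"
            by (rule mult_left_mono[OF less_imp_le[OF \<delta>(2)[OF \<open>norm x < \<delta>\<close>]] w(2)])
          finally show ?thesis .
        next
          case True
          then have "w n x = 0" by (rule w(3))
          then show ?thesis by simp
        qed
        have i1: "integrable lborel (\<lambda>x. w n x * (indicator X x * \<phi> x) - w n x * \<phi> 0)"
        proof (rule Bochner_Integration.integrable_bound[OF int_mult[of n d]])
          show "(\<lambda>x. w n x * (indicator X x * \<phi> x) - w n x * \<phi> 0) \<in> borel_measurable lborel"
            using m by simp
          have "norm (w n x * (indicator X x * \<phi> x) - w n x * \<phi> 0) \<le> norm (w n x * d)" for x
            using bd[of x] abs_ge_self[of "w n x * d"] by (simp only: real_norm_def)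
          then show "AE x in lborel. norm (w n x * (indicator X x * \<phi> x) - w n x * \<phi> 0)
              \<le> norm (w n x * d)"
            by (rule AE_I2)
        qed
        \<comment> \<open>Integrability of the product is recovered from the difference, since only
          the oscillation of \<open>\<phi>\<close> near the origin has been bounded.\<close>
        have i2: "integrable lborel (\<lambda>x. w n x * (indicator X x * \<phi> x))"
          using Bochner_Integration.integrable_add[OF i1 int_mult[of n "\<phi> 0"]] by (simp only: diff_add_cancel)
        have "(\<integral>x. w n x * (indicator X x * \<phi> x) \<partial>lborel) - (\<integral>x. w n x \<partial>lborel) * \<phi> 0
            = (\<integral>x. w n x * (indicator X x * \<phi> x) - w n x * \<phi> 0 \<partial>lborel)"
          by (simp only: Bochner_Integration.integral_diff[OF i2 int_mult] Bochner_Integration.integral_mult_left_zero)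
        also have "norm \<dots> \<le> (\<integral>x. w n x * d \<partial>lborel)"
          by (rule Bochner_Integration.integral_norm_bound_integral[OF i1 int_mult])
            (simp only: real_norm_def bd)
        also have "\<dots> = (\<integral>x. w n x \<partial>lborel) * d" by simp
        also have "\<dots> < (c + 1) * d" using Nn d by (simp only: mult_strict_right_mono)
        finally show "norm ((\<integral>x. w n x * (indicator X x * \<phi> x) \<partial>lborel)
          - (\<integral>x. w n x \<partial>lborel) * \<phi> 0 - 0) < e"
          unfolding diff_zero d(2)[symmetric] mult.commute[of d] .
      qed
    qed
    from tendsto_add[OF this tendsto_mult_right[OF c, of "\<phi> 0"]]
    show ?thesis unfolding I by simp
  qed
  show "weak_star_conv X T (\<lambda>n. density_on X (w n)) (point_mass X c)"
    unfolding weak_star_conv_def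
    using density_on_finite[OF X(1) int w(2)] point_mass_finite[OF X0 c0] conv
      integral_point_mass[OF X0 c0 T] by simp
qed

text \<open>The right-hand side is free of \<open>X\<close>, so one computation of the norms serves
  both the disk and the torus.\<close>

lemma Lp_norm_eq_integral:
  assumes "ball 0 1 \<subseteq> X" and "\<And>x. x \<notin> ball 0 1 \<Longrightarrow> f x = 0"
  shows "Lp_norm p X f = (\<integral>x. norm (f x) powr p \<partial>lborel) powr (1 / p)"
proof -
  have "f x = 0" if "x \<notin> X" for x
    using assms that by blast
  then have "indicator X x *\<^sub>R norm (f x) powr p = norm (f x) powr p" for x
    by (cases "x \<in> X") auto
  then show ?thesis by (simp only: Lp_norm_def set_lebesgue_integral_def)
qed

section \<open>Transfer to flat tori\<close>

lemma Lp_norm_cong: "(\<And>x. x \<in> X \<Longrightarrow> f x = g x) \<Longrightarrow> Lp_norm p X f = Lp_norm p X g"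
  unfolding Lp_norm_def set_lebesgue_integral_def
  by (rule arg_cong[where f = "\<lambda>c. c powr (1 / p)"], rule Bochner_Integration.integral_cong)
    (auto simp: indicator_def)

lemma density_on_cong:
  assumes "\<And>x. x \<in> X \<Longrightarrow> f x = g x" shows "density_on X f = density_on X g"
proof -
  have "(\<integral>\<^sup>+x. ennreal (f x) * indicator A x \<partial>restrict_space lborel X)
      = (\<integral>\<^sup>+x. ennreal (g x) * indicator A x \<partial>restrict_space lborel X)" for A
    using assms by (intro nn_integral_cong) (auto simp: space_restrict_space)
  then show ?thesis by (simp add: density_on_def density_def)
qed

text \<open>Differentiation does not enlarge the support; this keeps the support hypothesis
  available throughout the induction in \<open>C_k_periodize\<close>.\<close>

lemma frechet_derivative_outside_cball:
  assumes "\<And>z. norm z > r \<Longrightarrow> f z = 0" and "norm x > r"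
  shows "frechet_derivative f (at x) = (\<lambda>v. 0)"
proof -
  have "((\<lambda>_. 0) has_derivative (\<lambda>v. 0)) (at x)" by simp
  moreover have "open {z :: 'a. norm z > r}"
    by (intro open_Collect_less continuous_intros)
  ultimately have "(f has_derivative (\<lambda>v. 0)) (at x)"
    by (rule has_derivative_transform_within_open) (use assms in auto)
  from frechet_derivative_at[OF this] show ?thesis by simp
qed

context
  fixes \<Lambda> D :: "(real^2) set"
  assumes \<Lambda>: "lattice \<Lambda>" and D: "fundamental_domain \<Lambda> D" "ball 0 1 \<subseteq> D"
begin

lemma lattice_0: "0 \<in> \<Lambda>"
  and lattice_diff: "l \<in> \<Lambda> \<Longrightarrow> m \<in> \<Lambda> \<Longrightarrow> l - m \<in> \<Lambda>"
proof -
  obtain a b where L: "\<Lambda> = {of_int m *\<^sub>R a + of_int k *\<^sub>R b | m k. True}"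
    using \<Lambda> unfolding lattice_def by blast
  have I: "of_int m *\<^sub>R a + of_int k *\<^sub>R b \<in> \<Lambda>" for m k
    unfolding L by blast
  show "0 \<in> \<Lambda>" using I[of 0 0] by simp
  assume "l \<in> \<Lambda>" "m \<in> \<Lambda>"
  then obtain i j i' j' where *: "l = of_int i *\<^sub>R a + of_int j *\<^sub>R b"
      "m = of_int i' *\<^sub>R a + of_int j' *\<^sub>R b"
    unfolding L by blast
  show "l - m \<in> \<Lambda>" using I[of "i - i'" "j - j'"] by (simp add: * algebra_simps)
qed

section \<open>Periodization of fields supported strictly inside the unit disk\<close>

lemma ex_representative:
  obtains y where "y \<in> D" "y - x \<in> \<Lambda>"
  using D(1) unfolding fundamental_domain_def by blast

lemma representative_unique:
  assumes "y \<in> D" "y - x \<in> \<Lambda>" "y' \<in> D" "y' - x \<in> \<Lambda>"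
  shows "y = y'"
  using D(1) assms unfolding fundamental_domain_def by blast

lemma periodize_eq:
  assumes "y \<in> D" "y - x \<in> \<Lambda>"
  shows "periodize \<Lambda> D f x = f y"
proof -
  have "(THE y. y \<in> D \<and> y - x \<in> \<Lambda>) = y"
    using assms representative_unique by blast
  then show ?thesis by (simp add: periodize_def)
qed

lemma periodize_on_domain: "x \<in> D \<Longrightarrow> periodize \<Lambda> D f x = f x"
  by (rule periodize_eq) (simp_all add: lattice_0)

lemma periodic_periodize: "periodic \<Lambda> (periodize \<Lambda> D f)"
  unfolding periodic_def
proof (intro allI ballI)
  fix x l assume l: "l \<in> \<Lambda>"
  obtain y where y: "y \<in> D" "y - x \<in> \<Lambda>" by (rule ex_representative)
  have "y - (x + l) \<in> \<Lambda>"
    using lattice_diff[OF y(2) l] by (simp add: algebra_simps)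
  then show "periodize \<Lambda> D f (x + l) = periodize \<Lambda> D f x"
    using y by (simp add: periodize_eq)
qed

text \<open>If the representative \<open>y\<close> of \<open>x\<close> lies in the open disk, the
  translates of nearby points stay in the disk, hence in \<open>D\<close>. Otherwise both sides
  vanish within distance \<open>1 - r\<close> of \<open>x\<close>. Jumps of the representative
  across the boundary of \<open>D\<close> are therefore harmless.\<close>

lemma periodize_locally_translate:
  assumes "r < 1" and y: "y \<in> D" "y - x \<in> \<Lambda>"
  obtains S where "open S" "x \<in> S"
    "\<And>(f :: real^2 \<Rightarrow> 'b :: zero) z. (\<And>z. norm z > r \<Longrightarrow> f z = 0) \<Longrightarrow> z \<in> S \<Longrightarrow> periodize \<Lambda> D f z = f (z + (y - x))"
proof (cases "y \<in> ball 0 1")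
  case True
  show thesis
  proof
    show "open {z. norm (z + (y - x)) < 1}"
      by (intro open_Collect_less continuous_intros)
    show "x \<in> {z. norm (z + (y - x)) < 1}" using True by simp
    show "periodize \<Lambda> D f z = f (z + (y - x))" if "z \<in> {z. norm (z + (y - x)) < 1}"
      for f :: "real^2 \<Rightarrow> 'b" and z
      using that D(2) y(2) by (intro periodize_eq) auto
  qed
next
  case False
  show thesis
  proof
    show "open (ball x (1 - r))" "x \<in> ball x (1 - r)" using assms by auto
    fix f :: "real^2 \<Rightarrow> 'b" and z
    assume f: "\<And>z. norm z > r \<Longrightarrow> f z = 0" and z: "z \<in> ball x (1 - r)"
    then have zx: "norm (z - x) < 1 - r" by (simp add: dist_norm norm_minus_commute)
    \<comment> \<open>Here \<open>y\<close> has norm at least 1, so a shift shorter than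
      \<open>1 - r\<close> cannot bring it into the disk of radius \<open>r\<close>.\<close>
    have "norm y \<le> norm (z + (y - x)) + norm (z - x)"
      using norm_triangle_ineq4[of "z + (y - x)" "z - x"] by simp
    then have "norm (z + (y - x)) > r" using False zx by simp
    moreover have "periodize \<Lambda> D f z = 0"
    proof -
      obtain w where w: "w \<in> D" "w - z \<in> \<Lambda>" by (rule ex_representative)
      have "norm w > r"
      \<comment> \<open>Otherwise moving \<open>w\<close> back by \<open>z - x\<close> would give a
        point of the unit disk representing \<open>x\<close>; uniqueness would force it to be
        \<open>y\<close>, which lies outside that disk.\<close>
      proof (rule ccontr)
        assume "\<not> norm w > r"
        then have "norm (w - (z - x)) < 1"
          using norm_triangle_ineq4[of w "z - x"] zx by simp
        then have "w - (z - x) = y"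
          using D(2) w y by (intro representative_unique[of _ x]) auto
        then show False using False \<open>norm (w - (z - x)) < 1\<close> by simp
      qed
      then show ?thesis using f w by (simp add: periodize_eq)
    qed
    ultimately show "periodize \<Lambda> D f z = f (z + (y - x))" using f by simp
  qed
qed

lemma periodize_has_derivative:
  assumes "r < 1" and "\<And>z. norm z > r \<Longrightarrow> f z = 0" and "y \<in> D" "y - x \<in> \<Lambda>"
    and "f differentiable (at y)"
  shows "(periodize \<Lambda> D f has_derivative frechet_derivative f (at y)) (at x)"
proof -
  obtain S where S: "open S" "x \<in> S" "\<And>z. z \<in> S \<Longrightarrow> periodize \<Lambda> D f z = f (z + (y - x))"
    using periodize_locally_translate[OF assms(1,3,4)] assms(2) by metis
  have "(f has_derivative frechet_derivative f (at y)) (at (x + (y - x)))"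
    using assms(5) by (simp add: frechet_derivative_works)
  moreover have "((\<lambda>z. z + (y - x)) has_derivative (\<lambda>v. v)) (at x)"
    by (auto intro!: derivative_eq_intros)
  ultimately have "((\<lambda>z. f (z + (y - x))) has_derivative frechet_derivative f (at y)) (at x)"
    using has_derivative_compose by fastforce
  then show ?thesis
    by (rule has_derivative_transform_within_open[OF _ S(1,2)]) (simp add: S(3))
qed

lemma frechet_derivative_periodize:
  assumes "r < 1" and "\<And>z. norm z > r \<Longrightarrow> f z = 0" and "y \<in> D" "y - x \<in> \<Lambda>"
    and "f differentiable (at y)"
  shows "frechet_derivative (periodize \<Lambda> D f) (at x) = frechet_derivative f (at y)"
  using frechet_derivative_at[OF periodize_has_derivative[OF assms]] by simp

text \<open>Near each point the periodization is a translate, so its derivative is the periodization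
  of the derivative. The induction varies \<open>f\<close>, which is replaced by its directional
  derivatives.\<close>

lemma C_k_periodize:
  assumes "r < 1"
  shows "C_k k f \<Longrightarrow> (\<And>z. norm z > r \<Longrightarrow> f z = 0) \<Longrightarrow> C_k k (periodize \<Lambda> D f)"
proof (induction k arbitrary: f)
  case 0
  have "isCont (periodize \<Lambda> D f) x" for x
  proof -
    obtain y where y: "y \<in> D" "y - x \<in> \<Lambda>" by (rule ex_representative)
    obtain S where S: "open S" "x \<in> S" "\<And>z. z \<in> S \<Longrightarrow> periodize \<Lambda> D f z = f (z + (y - x))"
      using periodize_locally_translate[OF assms(1) y] 0(2) by metis
    have "isCont f (x + (y - x))"
      using 0(1) by (simp add: continuous_on_eq_continuous_at)
    moreover have "isCont (\<lambda>z. z + (y - x)) x"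
      by (intro continuous_intros)
    ultimately have "isCont (\<lambda>z. f (z + (y - x))) x"
      using isCont_o2[of x "\<lambda>z. z + (y - x)" f] by blast
    moreover have "\<forall>\<^sub>F z in nhds x. periodize \<Lambda> D f z = f (z + (y - x))"
      using S by (auto simp: eventually_nhds)
    ultimately show ?thesis using isCont_cong by metis
  qed
  then show ?case by (simp add: continuous_at_imp_continuous_on)
next
  case (Suc k)
  have d: "f differentiable (at y)" for y using Suc.prems(1) by simp
  show ?case
  proof (rule C_k_SucI)
    show "(periodize \<Lambda> D f has_derivative
        (\<lambda>v. periodize \<Lambda> D (\<lambda>y. frechet_derivative f (at y) v) x)) (at x)" for x
    proof -
      obtain y where y: "y \<in> D" "y - x \<in> \<Lambda>" by (rule ex_representative)
      have "(\<lambda>v. periodize \<Lambda> D (\<lambda>y. frechet_derivative f (at y) v) x) = frechet_derivative f (at y)"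
        using periodize_eq[OF y] by auto
      then show ?thesis
        using periodize_has_derivative[OF assms Suc.prems(2) y d] by simp
    qed
    show "C_k k (\<lambda>x. periodize \<Lambda> D (\<lambda>y. frechet_derivative f (at y) v) x)" for v
      using Suc.prems frechet_derivative_outside_cball[of r f]
      by (intro Suc.IH) auto
  qed
qed

lemma partial_deriv_periodize:
  assumes "r < 1" "\<And>z. norm z > r \<Longrightarrow> u z = 0" "smooth u" "y \<in> D" "y - x \<in> \<Lambda>"
  shows "partial_deriv i (\<lambda>z. periodize \<Lambda> D u z $ j) x = partial_deriv i (\<lambda>z. u z $ j) y"
proof -
  have "u differentiable (at y)"
    using assms(3) unfolding smooth_def by (metis C_k.simps(2))
  then have "(\<lambda>z. u z $ j) differentiable (at y)"
    by (auto simp: differentiable_def intro: bounded_linear.has_derivative[OF bounded_linear_vec_nth])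
  moreover have "(\<lambda>z. periodize \<Lambda> D u z $ j) = periodize \<Lambda> D (\<lambda>z. u z $ j)"
    by (simp add: periodize_def fun_eq_iff)
  ultimately show ?thesis
    unfolding partial_deriv_def
    using frechet_derivative_periodize[OF assms(1) _ assms(4,5), of "\<lambda>z. u z $ j"] assms(2) by simp
qed

text \<open>A point of \<open>D\<close> is its own representative, even on the boundary of
  \<open>D\<close>, where differentiation sees values outside \<open>D\<close>.\<close>

lemma curl_periodize_on_domain:
  assumes "r < 1" "\<And>z. norm z > r \<Longrightarrow> u z = 0" "smooth u" "x \<in> D"
  shows "curl (periodize \<Lambda> D u) x = curl u x"
  using partial_deriv_periodize[OF assms(1,2,3,4), of x] lattice_0 by (simp add: curl_def)

lemma incompressible_periodize:
  assumes "r < 1" "\<And>z. norm z > r \<Longrightarrow> u z = 0" "smooth u" "incompressible u"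
  shows "incompressible (periodize \<Lambda> D u)"
  unfolding incompressible_def
proof
  fix x
  obtain y where y: "y \<in> D" "y - x \<in> \<Lambda>" by (rule ex_representative)
  show "partial_deriv 1 (\<lambda>z. periodize \<Lambda> D u z $ 1) x + partial_deriv 2 (\<lambda>z. periodize \<Lambda> D u z $ 2) x = 0"
    using partial_deriv_periodize[OF assms(1,2,3) y] assms(4) by (simp add: incompressible_def)
qed

lemma smooth_periodize:
  assumes "r < 1" "\<And>z. norm z > r \<Longrightarrow> u z = 0" "smooth u"
  shows "smooth (periodize \<Lambda> D u)"
  unfolding smooth_def
proof
  show "C_k k (periodize \<Lambda> D u)" for k
    by (rule C_k_periodize[OF assms(1)]) (use assms(2,3) in \<open>simp_all add: smooth_def\<close>)
qed

end

section \<open>Concentrating sequences of vortices\<close>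

text \<open>The set where \<open>f\<close> is nonzero is open and null, hence empty.\<close>

lemma continuous_AE_0:
  fixes f :: "real \<Rightarrow> real"
  assumes "continuous_on UNIV f" and "AE x in lborel. f x = 0"
  shows "f x = 0"
proof -
  have "open {x. f x \<noteq> 0}"
    using assms(1) by (intro open_Collect_neq continuous_intros)
  moreover have "{x. f x \<noteq> 0} \<in> null_sets lborel"
    using assms(2) \<open>open {x. f x \<noteq> 0}\<close> by (subst (asm) AE_iff_null) auto
  then have "negligible {x. f x \<noteq> 0}"
    by (simp add: negligible_iff_null_sets null_sets_completionI)
  ultimately show ?thesis using open_not_negligible by blast
qed

section \<open>Integrals of the bump function\<close>

lemma bump_eq_0: "t \<notin> {0<..<1} \<Longrightarrow> bump t = 0"
  by (simp add: bump_eq_0_iff)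

lemma deriv_bump_eq_0: "t \<notin> {0..1} \<Longrightarrow> deriv bump t = 0"
  using deriv_eq_0_less[of 0 bump t] deriv_eq_0_greater[of 1 bump t] by (force simp: bump_eq_0_iff)

lemma integrable_continuous_unit_support:
  fixes f :: "real \<Rightarrow> real"
  assumes "continuous_on UNIV f" and "\<And>t. t \<notin> {0..1} \<Longrightarrow> f t = 0"
  shows "integrable lborel f"
proof -
  have "(\<lambda>t. indicator {0..1} t *\<^sub>R f t) = f"
    using assms(2) by (force simp: indicator_def)
  moreover have "continuous_on {0..1} f"
    using assms(1) by (rule continuous_on_subset) simp
  ultimately show ?thesis
    using borel_integrable_compact[of "{0..1}" f] by simp
qed

lemma continuous_bump: "continuous_on UNIV bump" "continuous_on UNIV (deriv bump)"
  using smooth_continuous smooth_bump smooth_real_deriv(2) by blast+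

lemma integrable_bump:
  "integrable lborel (\<lambda>t. (bump t)\<^sup>2)" "integrable lborel (\<lambda>t. \<bar>bump t\<bar>)"
  "integrable lborel (\<lambda>t. \<bar>deriv bump t\<bar>)"
  by (rule integrable_continuous_unit_support,
      use bump_eq_0 deriv_bump_eq_0 in \<open>auto intro!: continuous_intros continuous_bump\<close>)+

lemma integral_bump_sq_pos: "0 < (\<integral>t. (bump t)\<^sup>2 \<partial>lborel)"
proof (rule ccontr)
  assume "\<not> ?thesis"
  moreover have "0 \<le> (\<integral>t. (bump t)\<^sup>2 \<partial>lborel)" by simp
  ultimately have "(\<integral>t. (bump t)\<^sup>2 \<partial>lborel) = 0" by linarith
  then have "AE t in lborel. bump t = 0"
    by (subst (asm) integral_nonneg_eq_0_iff_AE[OF integrable_bump(1)]) auto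
  from continuous_AE_0[OF continuous_bump(1) this, of "1 / 2"]
  show False by (simp add: bump_eq_0_iff)
qed

text \<open>With zero total variation the bump would be constant, yet it is 0 at 0 and nonzero at
  1/2. The limit mass in (i) is a multiple of this integral.\<close>

lemma integral_deriv_bump_pos: "0 < (\<integral>t. \<bar>deriv bump t\<bar> \<partial>lborel)"
proof (rule ccontr)
  assume "\<not> ?thesis"
  moreover have "0 \<le> (\<integral>t. \<bar>deriv bump t\<bar> \<partial>lborel)" by simp
  ultimately have "(\<integral>t. \<bar>deriv bump t\<bar> \<partial>lborel) = 0" by linarith
  then have "AE t in lborel. deriv bump t = 0"
    by (subst (asm) integral_nonneg_eq_0_iff_AE[OF integrable_bump(3)]) auto
  then have "deriv bump t = 0" for t
    by (rule continuous_AE_0[OF continuous_bump(2)])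
  then have "(bump has_real_derivative 0) (at t)" for t
    using smooth_real_deriv(1)[OF smooth_bump] by metis
  then have "bump (1 / 2) = bump 0"
    by (intro DERIV_isconst_all) auto
  then show False using bump_eq_0[of 0] bump_eq_0_iff[of "1 / 2"] by simp
qed

section \<open>Rescaled bumps: energy, total variation and weighted mass\<close>

definition rescaled_bump :: "real \<Rightarrow> real \<Rightarrow> real \<Rightarrow> real \<Rightarrow> real" where
  "rescaled_bump c a d t = c * bump (d + a * t)"

lemma smooth_rescaled_bump: "smooth (rescaled_bump c a d)"
proof -
  have "C_k k (\<lambda>t. d + a * t)" for k
    by (rule C_k_add[OF C_k_const C_k_mult[OF C_k_const C_k_linear[OF bounded_linear_ident]]])
  from C_k_mult[OF C_k_const C_k_compose_real[OF _ this]] smooth_bump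
  show ?thesis unfolding smooth_def rescaled_bump_def[abs_def] by blast
qed

lemma deriv_rescaled_bump: "deriv (rescaled_bump c a d) t = c * (a * deriv bump (d + a * t))"
  unfolding rescaled_bump_def[abs_def]
  by (rule DERIV_imp_deriv)
    (auto intro!: derivative_eq_intros DERIV_chain2[OF smooth_real_deriv(1)[OF smooth_bump]])

lemma integral_rescaled_bump_sq:
  assumes "a > 0"
  shows "(\<integral>t. (rescaled_bump c a d t)\<^sup>2 \<partial>lborel) = c\<^sup>2 / a * (\<integral>t. (bump t)\<^sup>2 \<partial>lborel)"
  using assms lborel_integral_real_affine[of a "\<lambda>t. (bump t)\<^sup>2" d]
  by (simp add: rescaled_bump_def power_mult_distrib)

text \<open>The factor \<open>a\<close> from the chain rule cancels the \<open>1 / a\<close> from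
  the substitution. The energy in \<open>integral_rescaled_bump_sq\<close> keeps its
  \<open>1 / a\<close>, and both constructions exploit this mismatch.\<close>

lemma integral_deriv_rescaled_bump:
  assumes "a > 0"
  shows "(\<integral>t. \<bar>deriv (rescaled_bump c a d) t\<bar> \<partial>lborel) = \<bar>c\<bar> * (\<integral>t. \<bar>deriv bump t\<bar> \<partial>lborel)"
  using assms lborel_integral_real_affine[of a "\<lambda>t. \<bar>deriv bump t\<bar>" d]
  by (simp add: deriv_rescaled_bump abs_mult)

text \<open>For \<open>t \<ge> l\<close> the weight is at most \<open>exp (- l / 2)\<close>; a
  substitution evaluates what remains.\<close>

lemma integral_rescaled_bump_exp_le:
  assumes "a > 0" and "\<And>t. t < l \<Longrightarrow> rescaled_bump c a d t = 0"
  shows "(\<integral>t. \<bar>rescaled_bump c a d t\<bar> * exp (- t / 2) \<partial>lborel)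
    \<le> exp (- l / 2) * (\<bar>c\<bar> / a * (\<integral>t. \<bar>bump t\<bar> \<partial>lborel))"
proof -
  have i: "integrable lborel (\<lambda>t. \<bar>bump (d + a * t)\<bar>)"
    using assms(1) lborel_integrable_real_affine[OF integrable_bump(2), of a d] by simp
  have "(\<integral>t. \<bar>rescaled_bump c a d t\<bar> * exp (- t / 2) \<partial>lborel)
      \<le> (\<integral>t. exp (- l / 2) * (\<bar>c\<bar> * \<bar>bump (d + a * t)\<bar>) \<partial>lborel)"
  proof (rule integral_mono')
    show "integrable lborel (\<lambda>t. exp (- l / 2) * (\<bar>c\<bar> * \<bar>bump (d + a * t)\<bar>))"
      using i by simp
    fix t :: real
    show "\<bar>rescaled_bump c a d t\<bar> * exp (- t / 2) \<le> exp (- l / 2) * (\<bar>c\<bar> * \<bar>bump (d + a * t)\<bar>)"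
    proof (cases "t < l")
      case True
      then show ?thesis using assms(2) by simp
    next
      case False
      then have "\<bar>c\<bar> * \<bar>bump (d + a * t)\<bar> * exp (- t / 2) \<le> \<bar>c\<bar> * \<bar>bump (d + a * t)\<bar> * exp (- l / 2)"
        by (intro mult_left_mono) auto
      then show ?thesis by (simp add: rescaled_bump_def abs_mult mult_ac)
    qed
  qed simp
  also have "\<dots> = exp (- l / 2) * (\<bar>c\<bar> / a * (\<integral>t. \<bar>bump t\<bar> \<partial>lborel))"
    using assms(1) lborel_integral_real_affine[of a "\<lambda>t. \<bar>bump t\<bar>" d] by simp
  finally show ?thesis .
qed

section \<open>Norms and weak* limits of a sequence of vortices\<close>

lemma Lp_norm_1_eq_integral:
  assumes "ball 0 1 \<subseteq> X" and "\<And>x. x \<notin> ball 0 1 \<Longrightarrow> f x = 0"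
  shows "Lp_norm 1 X f = (\<integral>x. norm (f x) \<partial>lborel)"
  using Lp_norm_eq_integral[OF assms, where p = 1] by simp

lemma Lp_norm_2_eq_integral:
  assumes "ball 0 1 \<subseteq> X" and "\<And>x. x \<notin> ball 0 1 \<Longrightarrow> f x = 0"
  shows "Lp_norm 2 X f = sqrt (\<integral>x. (norm (f x))\<^sup>2 \<partial>lborel)"
  using Lp_norm_eq_integral[OF assms, where p = 2] by (simp add: powr_half_sqrt)

text \<open>\<open>a n\<close> keeps the support away from the unit circle and, tending to infinity,
  drives the concentration; \<open>b n\<close> keeps the field zero near the origin.\<close>

locale vortex_sequence =
  fixes g :: "nat \<Rightarrow> real \<Rightarrow> real" and a b :: "nat \<Rightarrow> real"
  assumes g: "\<And>n. smooth (g n)" and ga: "\<And>n t. t < a n \<Longrightarrow> g n t = 0"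
    and gb: "\<And>n t. t > b n \<Longrightarrow> g n t = 0"
    and a: "\<And>n. a n > 0" "filterlim a at_top sequentially"
begin

lemma radius_less_1: "exp (- a n / 2) < 1"
  using a(1)[of n] by simp

lemma radius_tendsto_0: "(\<lambda>n. exp (- a n / 2)) \<longlonglongrightarrow> 0"
proof -
  have "((\<lambda>t::real. exp (- t / 2)) \<longlongrightarrow> 0) at_top" by real_asymp
  from filterlim_compose[OF this a(2)] show ?thesis .
qed

lemma vortex_outside: "norm x > exp (- a n / 2) \<Longrightarrow> vortex (g n) x = 0"
  by (rule vortex_eq_0[OF ga])

lemma curl_vortex_outside:
  assumes "norm x > exp (- a n / 2)"
  shows "curl (vortex (g n)) x = 0"
  using frechet_derivative_outside_cball[of "exp (- a n / 2)" "\<lambda>y. vortex (g n) y $ _" x]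
    vortex_outside assms
  by (simp add: curl_def partial_deriv_def)

lemma vortex_n_in_Cc_smooth: "vortex (g n) \<in> Cc_smooth (ball 0 1)"
  by (rule vortex_in_Cc_smooth[OF g gb ga a(1)])

lemma incompressible_vortex_n: "incompressible (vortex (g n))"
  by (rule incompressible_vortex[OF g gb])

lemma smooth_vortex_n: "smooth (vortex (g n))"
  by (rule smooth_vortex[OF g gb])

lemma vortex_outside_ball:
  assumes "x \<notin> ball 0 1" shows "vortex (g n) x = 0" "curl (vortex (g n)) x = 0"
proof -
  have "exp (- a n / 2) < norm x"
    by (rule less_le_trans[OF radius_less_1]) (use assms in simp)
  then show "vortex (g n) x = 0" "curl (vortex (g n)) x = 0"
    by (rule vortex_outside, rule curl_vortex_outside)
qed

lemma
  assumes "ball 0 1 \<subseteq> X"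
  shows Lp_norm_2_vortex: "Lp_norm 2 X (vortex (g n)) = sqrt (pi * (\<integral>t. (g n t)\<^sup>2 \<partial>lborel))"
    and Lp_norm_1_vortex: "Lp_norm 1 X (vortex (g n)) = pi * (\<integral>t. \<bar>g n t\<bar> * exp (- t / 2) \<partial>lborel)"
    and Lp_norm_1_curl_vortex: "Lp_norm 1 X (curl (vortex (g n))) = 2 * pi * (\<integral>t. \<bar>deriv (g n) t\<bar> \<partial>lborel)"
  using Lp_norm_2_eq_integral[OF assms vortex_outside_ball(1)]
    Lp_norm_1_eq_integral[OF assms vortex_outside_ball(1)]
    Lp_norm_1_eq_integral[OF assms vortex_outside_ball(2)]
    integral_norm_vortex_sq[OF g gb] integral_norm_vortex[OF g gb] integral_abs_curl_vortex[OF g gb]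
  by simp_all

text \<open>In both cases the limit is the Dirac mass at the origin whose weight is the limit of the
  total masses.\<close>

lemma
  assumes "X \<in> sets borel" "ball 0 1 \<subseteq> X" "\<And>\<phi>. \<phi> \<in> T \<Longrightarrow> continuous_on X \<phi>"
  shows concentration_curl_vortex:
      "(\<lambda>n. 2 * pi * (\<integral>t. \<bar>deriv (g n) t\<bar> \<partial>lborel)) \<longlonglongrightarrow> c \<Longrightarrow> c > 0 \<Longrightarrow>
        \<exists>\<Omega>. weak_star_conv X T (\<lambda>n. density_on X (\<lambda>x. \<bar>curl (vortex (g n)) x\<bar>)) \<Omega> \<and>
          measure \<Omega> {0} > 0"
    and concentration_vortex_sq:
      "(\<lambda>n. pi * (\<integral>t. (g n t)\<^sup>2 \<partial>lborel)) \<longlonglongrightarrow> c \<Longrightarrow> c > 0 \<Longrightarrow>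
        \<exists>M. weak_star_conv X T (\<lambda>n. density_on X (\<lambda>x. (norm (vortex (g n) x))\<^sup>2)) M \<and>
          measure M {0} > 0"
proof -
  assume c: "(\<lambda>n. 2 * pi * (\<integral>t. \<bar>deriv (g n) t\<bar> \<partial>lborel)) \<longlonglongrightarrow> c" "c > 0"
  have *: "continuous_on UNIV (\<lambda>x. \<bar>curl (vortex (g n)) x\<bar>)" for n
    by (intro continuous_intros continuous_curl smooth_vortex_n)
  have "weak_star_conv X T (\<lambda>n. density_on X (\<lambda>x. \<bar>curl (vortex (g n)) x\<bar>)) (point_mass X c)"
    by (rule weak_star_conv_point_mass[OF assms * _ _ radius_tendsto_0])
      (use c(1) in \<open>simp_all add: curl_vortex_outside integral_abs_curl_vortex[OF g gb]\<close>)
  moreover have "measure (point_mass X c) {0} = c"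
    using assms(2) c(2) by (intro measure_point_mass) auto
  ultimately show "\<exists>\<Omega>. weak_star_conv X T (\<lambda>n. density_on X (\<lambda>x. \<bar>curl (vortex (g n)) x\<bar>)) \<Omega> \<and>
      measure \<Omega> {0} > 0"
    using c(2) by auto
next
  assume c: "(\<lambda>n. pi * (\<integral>t. (g n t)\<^sup>2 \<partial>lborel)) \<longlonglongrightarrow> c" "c > 0"
  have *: "continuous_on UNIV (\<lambda>x. (norm (vortex (g n) x))\<^sup>2)" for n
    by (intro continuous_intros smooth_continuous smooth_vortex_n)
  have "weak_star_conv X T (\<lambda>n. density_on X (\<lambda>x. (norm (vortex (g n) x))\<^sup>2)) (point_mass X c)"
    by (rule weak_star_conv_point_mass[OF assms * _ _ radius_tendsto_0])
      (use c(1) in \<open>simp_all add: vortex_outside integral_norm_vortex_sq[OF g gb]\<close>)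
  moreover have "measure (point_mass X c) {0} = c"
    using assms(2) c(2) by (intro measure_point_mass) auto
  ultimately show "\<exists>M. weak_star_conv X T (\<lambda>n. density_on X (\<lambda>x. (norm (vortex (g n) x))\<^sup>2)) M \<and>
      measure M {0} > 0"
    using c(2) by auto
qed

text \<open>The periodized field and its curl agree with the originals at every point of
  \<open>D\<close>, so norms and densities over \<open>D\<close> carry over.\<close>

lemma
  assumes "lattice \<Lambda>" "fundamental_domain \<Lambda> D" "ball 0 1 \<subseteq> D"
  shows periodize_vortex: "smooth (periodize \<Lambda> D (vortex (g n)))"
      "periodic \<Lambda> (periodize \<Lambda> D (vortex (g n)))" "incompressible (periodize \<Lambda> D (vortex (g n)))"
    and Lp_norm_periodize_vortex: "Lp_norm p D (periodize \<Lambda> D (vortex (g n))) = Lp_norm p D (vortex (g n))"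
    and Lp_norm_curl_periodize_vortex:
      "Lp_norm p D (curl (periodize \<Lambda> D (vortex (g n)))) = Lp_norm p D (curl (vortex (g n)))"
    and density_on_periodize_vortex:
      "density_on D (\<lambda>x. (norm (periodize \<Lambda> D (vortex (g n)) x))\<^sup>2)
        = density_on D (\<lambda>x. (norm (vortex (g n) x))\<^sup>2)"
    and density_on_curl_periodize_vortex:
      "density_on D (\<lambda>x. \<bar>curl (periodize \<Lambda> D (vortex (g n))) x\<bar>)
        = density_on D (\<lambda>x. \<bar>curl (vortex (g n)) x\<bar>)"
proof -
  show "smooth (periodize \<Lambda> D (vortex (g n)))"
    by (rule smooth_periodize[OF assms radius_less_1 vortex_outside smooth_vortex_n])
  show "periodic \<Lambda> (periodize \<Lambda> D (vortex (g n)))"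
    by (rule periodic_periodize[OF assms])
  show "incompressible (periodize \<Lambda> D (vortex (g n)))"
    by (rule incompressible_periodize[OF assms radius_less_1 vortex_outside smooth_vortex_n incompressible_vortex_n])
  have c: "curl (periodize \<Lambda> D (vortex (g n))) x = curl (vortex (g n)) x" if "x \<in> D" for x
    by (rule curl_periodize_on_domain[OF assms radius_less_1 vortex_outside smooth_vortex_n that])
  show "Lp_norm p D (periodize \<Lambda> D (vortex (g n))) = Lp_norm p D (vortex (g n))"
    by (rule Lp_norm_cong) (rule periodize_on_domain[OF assms])
  show "Lp_norm p D (curl (periodize \<Lambda> D (vortex (g n)))) = Lp_norm p D (curl (vortex (g n)))"
    by (rule Lp_norm_cong) (rule c)
  show "density_on D (\<lambda>x. (norm (periodize \<Lambda> D (vortex (g n)) x))\<^sup>2)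
      = density_on D (\<lambda>x. (norm (vortex (g n) x))\<^sup>2)"
    by (rule density_on_cong) (simp only: periodize_on_domain[OF assms])
  show "density_on D (\<lambda>x. \<bar>curl (periodize \<Lambda> D (vortex (g n))) x\<bar>)
      = density_on D (\<lambda>x. \<bar>curl (vortex (g n)) x\<bar>)"
    by (rule density_on_cong) (simp only: c)
qed

end

section \<open>Choice of the two sequences\<close>

lemma C_0_continuous: "\<phi> \<in> C_0 X \<Longrightarrow> continuous_on X \<phi>"
  by (simp add: C_0_def)

lemma C_torus_continuous: "\<phi> \<in> C_torus \<Lambda> \<Longrightarrow> continuous_on X \<phi>"
  unfolding C_torus_def by (auto intro: continuous_on_subset)

lemma fundamental_domain_borel: "fundamental_domain \<Lambda> D \<Longrightarrow> D \<in> sets borel"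
  by (simp add: fundamental_domain_def)

theorem proposition7p1:
  "(\<exists>u :: nat \<Rightarrow> real^2 \<Rightarrow> real^2.
      (\<forall>n. u n \<in> Cc_smooth (ball 0 1) \<and> incompressible (u n)) \<and>
      (\<lambda>n. Lp_norm 2 (ball 0 1) (u n)) \<longlonglongrightarrow> 0 \<and>
      (\<exists>\<Omega>. weak_star_conv (ball 0 1) (C_0 (ball 0 1))
              (\<lambda>n. density_on (ball 0 1) (\<lambda>x. \<bar>curl (u n) x\<bar>)) \<Omega> \<and>
            measure \<Omega> {0} > 0) \<and>
      (\<forall>\<Lambda> D. lattice \<Lambda> \<and> fundamental_domain \<Lambda> D \<and> ball 0 1 \<subseteq> D \<longrightarrow>
         (let U = (\<lambda>n. periodize \<Lambda> D (u n)) in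
            (\<forall>n. smooth (U n) \<and> periodic \<Lambda> (U n) \<and> incompressible (U n)) \<and>
            (\<lambda>n. Lp_norm 2 D (U n)) \<longlonglongrightarrow> 0 \<and>
            (\<exists>\<Omega>. weak_star_conv D (C_torus \<Lambda>)
                    (\<lambda>n. density_on D (\<lambda>x. \<bar>curl (U n) x\<bar>)) \<Omega> \<and>
                  measure \<Omega> {0} > 0))))
   \<and>
   (\<exists>u :: nat \<Rightarrow> real^2 \<Rightarrow> real^2.
      (\<forall>n. u n \<in> Cc_smooth (ball 0 1) \<and> incompressible (u n)) \<and>
      (\<forall>n. Lp_norm 2 (ball 0 1) (u n) = 1) \<and>
      (\<lambda>n. Lp_norm 1 (ball 0 1) (u n) + Lp_norm 1 (ball 0 1) (curl (u n))) \<longlonglongrightarrow> 0 \<and>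
      (\<exists>M. weak_star_conv (ball 0 1) (C_0 (ball 0 1))
              (\<lambda>n. density_on (ball 0 1) (\<lambda>x. (norm (u n x))\<^sup>2)) M \<and>
            measure M {0} > 0) \<and>
      (\<forall>\<Lambda> D. lattice \<Lambda> \<and> fundamental_domain \<Lambda> D \<and> ball 0 1 \<subseteq> D \<longrightarrow>
         (let U = (\<lambda>n. periodize \<Lambda> D (u n)) in
            (\<forall>n. smooth (U n) \<and> periodic \<Lambda> (U n) \<and> incompressible (U n)) \<and>
            (\<forall>n. Lp_norm 2 D (U n) = 1) \<and>
            (\<lambda>n. Lp_norm 1 D (U n) + Lp_norm 1 D (curl (U n))) \<longlonglongrightarrow> 0 \<and>
            (\<exists>M. weak_star_conv D (C_torus \<Lambda>)
                    (\<lambda>n. density_on D (\<lambda>x. (norm (U n x))\<^sup>2)) M \<and>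
                  measure M {0} > 0))))"
proof -
  \<comment> \<open>The shift by 1 avoids a zero dilation at \<open>n = 0\<close>.\<close>
  define N where "N n = real n + 1" for n
  have N: "N n > 0" "N n \<ge> 1" for n by (simp_all add: N_def)
  have N_lim: "filterlim N at_top sequentially"
    unfolding N_def by real_asymp
  define I where "I = (\<integral>t. (bump t)\<^sup>2 \<partial>lborel)"
  define J where "J = (\<integral>t. \<bar>deriv bump t\<bar> \<partial>lborel)"
  define B where "B = (\<integral>t. \<bar>bump t\<bar> \<partial>lborel)"
  have I: "I > 0" and J: "J > 0"
    using integral_bump_sq_pos integral_deriv_bump_pos by (simp_all add: I_def J_def)
  show ?thesis
  proof (rule conjI, goal_cases)
    case 1
    show ?case
    proof -
      \<comment> \<open>The profile is \<open>bump\<close> at \<open>N (t - N)\<close>, supported in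
        \<open>[N, N + 1/N]\<close>: the energy decays like \<open>1 / N\<close> while the total
        variation stays \<open>J\<close>.\<close>
      define g where "g n = rescaled_bump 1 (N n) (- (N n)\<^sup>2)" for n
      have g: "smooth (g n)" for n
        by (simp add: g_def smooth_rescaled_bump)
      have ga: "g n t = 0" if "t < N n" for n t
      proof -
        have "N n * t < N n * N n" using that N(1) by simp
        then show ?thesis
          by (simp add: g_def rescaled_bump_def bump_eq_0_iff power2_eq_square)
      qed
      \<comment> \<open>The exact right end is \<open>N + 1/N\<close>; \<open>N n \<ge> 1\<close>
        allows the simpler bound.\<close>
      have gb: "g n t = 0" if "t > N n + 1" for n t
      proof -
        have "N n * t > N n * (N n + 1)" using that N(1) by simp
        then have "- (N n)\<^sup>2 + N n * t > 1"
          using N(2)[of n] by (simp add: power2_eq_square algebra_simps)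
        then show ?thesis
          by (simp add: g_def rescaled_bump_def bump_eq_0_iff)
      qed
      interpret vortex_sequence g N "\<lambda>n. N n + 1"
        by unfold_locales (fact g ga gb N(1) N_lim)+
      have sq: "pi * (\<integral>t. (g n t)\<^sup>2 \<partial>lborel) = pi * I / N n" for n
        using integral_rescaled_bump_sq[OF N(1)] by (simp add: g_def I_def)
      have cu: "2 * pi * (\<integral>t. \<bar>deriv (g n) t\<bar> \<partial>lborel) = 2 * pi * J" for n
        using integral_deriv_rescaled_bump[OF N(1)] by (simp add: g_def J_def)
      have L2: "(\<lambda>n. Lp_norm 2 X (vortex (g n))) \<longlonglongrightarrow> 0" if "ball 0 1 \<subseteq> X" for X
        unfolding Lp_norm_2_vortex[OF that] sq N_def using I by real_asymp
      have conc: "\<exists>\<Omega>. weak_star_conv X T (\<lambda>n. density_on X (\<lambda>x. \<bar>curl (vortex (g n)) x\<bar>)) \<Omega> \<and>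
          measure \<Omega> {0} > 0"
        if "X \<in> sets borel" "ball 0 1 \<subseteq> X" "\<And>\<phi>. \<phi> \<in> T \<Longrightarrow> continuous_on X \<phi>" for X T
        by (rule concentration_curl_vortex[where c = "2 * pi * J"]) (use that J in \<open>simp_all add: cu\<close>)
      show ?thesis
      proof (intro exI[of _ "\<lambda>n. vortex (g n)"] conjI allI impI)
        show "\<exists>\<Omega>. weak_star_conv (ball 0 1) (C_0 (ball 0 1))
            (\<lambda>n. density_on (ball 0 1) (\<lambda>x. \<bar>curl (vortex (g n)) x\<bar>)) \<Omega> \<and> 0 < measure \<Omega> {0}"
          by (rule conc) (simp_all add: C_0_continuous)
        fix \<Lambda> D :: "(real^2) set"
        assume "lattice \<Lambda> \<and> fundamental_domain \<Lambda> D \<and> ball 0 1 \<subseteq> D"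
        then have D: "lattice \<Lambda>" "fundamental_domain \<Lambda> D" "ball 0 1 \<subseteq> D" by auto
        show "let U = \<lambda>n. periodize \<Lambda> D (vortex (g n)) in
            (\<forall>n. smooth (U n) \<and> periodic \<Lambda> (U n) \<and> incompressible (U n)) \<and>
            (\<lambda>n. Lp_norm 2 D (U n)) \<longlonglongrightarrow> 0 \<and>
            (\<exists>\<Omega>. weak_star_conv D (C_torus \<Lambda>) (\<lambda>n. density_on D (\<lambda>x. \<bar>curl (U n) x\<bar>)) \<Omega> \<and>
              0 < measure \<Omega> {0})"
          unfolding Let_def Lp_norm_periodize_vortex[OF D] density_on_curl_periodize_vortex[OF D]
          using periodize_vortex[OF D] L2[OF D(3)]
            conc[OF fundamental_domain_borel[OF D(2)] D(3), of "C_torus \<Lambda>"] C_torus_continuous by blast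
      qed (simp_all only: vortex_n_in_Cc_smooth incompressible_vortex_n L2 order_refl)
    qed
  next
    case 2
    show ?case
    proof -
      \<comment> \<open>Chosen so that \<open>pi * (k n)\<^sup>2 * N n * I = 1\<close>, the required
        energy normalisation.\<close>
      define k where "k n = 1 / sqrt (pi * N n * I)" for n
      \<comment> \<open>Stretching \<open>bump\<close> by the factor \<open>N n\<close> places the
        support in \<open>[N n, 2 * N n]\<close>.\<close>
      define g where "g n = rescaled_bump (k n) (1 / N n) (- 1)" for n
      have k: "k n > 0" "(k n)\<^sup>2 = 1 / (pi * N n * I)" for n
        using N(1)[of n] I by (simp_all add: k_def power_divide)
      have g: "smooth (g n)" for n
        by (simp add: g_def smooth_rescaled_bump)
      have ga: "g n t = 0" if "t < N n" for n t
        using that N(1)[of n] by (simp add: g_def rescaled_bump_def bump_eq_0_iff field_simps)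
      have gb: "g n t = 0" if "t > 2 * N n" for n t
        using that N(1)[of n] by (simp add: g_def rescaled_bump_def bump_eq_0_iff field_simps)
      interpret vortex_sequence g N "\<lambda>n. 2 * N n"
        by unfold_locales (fact g ga gb N(1) N_lim)+
      have N': "1 / N n > 0" for n using N(1)[of n] by simp
      have sq: "pi * (\<integral>t. (g n t)\<^sup>2 \<partial>lborel) = 1" for n
        using integral_rescaled_bump_sq[OF N'] N(1)[of n] I k(2)[of n]
        by (simp add: g_def I_def[symmetric])
      have cu: "2 * pi * (\<integral>t. \<bar>deriv (g n) t\<bar> \<partial>lborel) = 2 * pi * (k n * J)" for n
        using integral_deriv_rescaled_bump[OF N'] k(1)[of n] by (simp add: g_def J_def)
      \<comment> \<open>The stretched bump has integral proportional to \<open>k n * N n\<close>,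
        which grows; the exponential weight on \<open>t \<ge> N n\<close> outweighs it.\<close>
      have ex: "pi * (\<integral>t. \<bar>g n t\<bar> * exp (- t / 2) \<partial>lborel) \<le> pi * (exp (- N n / 2) * (k n * N n * B))" for n
      proof -
        have "(\<integral>t. \<bar>g n t\<bar> * exp (- t / 2) \<partial>lborel) \<le> exp (- N n / 2) * (\<bar>k n\<bar> / (1 / N n) * B)"
          unfolding g_def B_def
          by (rule integral_rescaled_bump_exp_le[OF N']) (rule ga[unfolded g_def])
        then show ?thesis using k(1)[of n] by simp
      qed
      have L2: "Lp_norm 2 X (vortex (g n)) = 1" if "ball 0 1 \<subseteq> X" for X n
        unfolding Lp_norm_2_vortex[OF that] sq by simp
      have L1: "(\<lambda>n. Lp_norm 1 X (vortex (g n)) + Lp_norm 1 X (curl (vortex (g n)))) \<longlonglongrightarrow> 0"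
        if "ball 0 1 \<subseteq> X" for X
      proof (rule tendsto_sandwich[OF _ _ tendsto_const])
        show "\<forall>\<^sub>F n in sequentially. 0 \<le> Lp_norm 1 X (vortex (g n)) + Lp_norm 1 X (curl (vortex (g n)))"
          by (simp add: Lp_norm_def)
        show "\<forall>\<^sub>F n in sequentially. Lp_norm 1 X (vortex (g n)) + Lp_norm 1 X (curl (vortex (g n)))
            \<le> pi * (exp (- N n / 2) * (k n * N n * B)) + 2 * pi * (k n * J)"
          unfolding Lp_norm_1_vortex[OF that] Lp_norm_1_curl_vortex[OF that] cu
          using ex by simp
        show "(\<lambda>n. pi * (exp (- N n / 2) * (k n * N n * B)) + 2 * pi * (k n * J)) \<longlonglongrightarrow> 0"
        proof -
          have "k \<longlonglongrightarrow> 0"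
            unfolding k_def N_def using I by real_asymp
          moreover have "(\<lambda>n. exp (- N n / 2) * N n) \<longlonglongrightarrow> 0"
            unfolding N_def by real_asymp
          ultimately have "(\<lambda>n. pi * B * (k n * (exp (- N n / 2) * N n)) + 2 * pi * J * k n)
              \<longlonglongrightarrow> pi * B * (0 * 0) + 2 * pi * J * 0"
            by (intro tendsto_intros)
          then show ?thesis by (simp add: mult_ac)
        qed
      qed
      have conc: "\<exists>M. weak_star_conv X T (\<lambda>n. density_on X (\<lambda>x. (norm (vortex (g n) x))\<^sup>2)) M \<and>
          measure M {0} > 0"
        if "X \<in> sets borel" "ball 0 1 \<subseteq> X" "\<And>\<phi>. \<phi> \<in> T \<Longrightarrow> continuous_on X \<phi>" for X T
        by (rule concentration_vortex_sq[where c = 1]) (use that in \<open>simp_all add: sq\<close>)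
      show ?thesis
      proof (intro exI[of _ "\<lambda>n. vortex (g n)"] conjI allI impI)
        show "\<exists>M. weak_star_conv (ball 0 1) (C_0 (ball 0 1))
            (\<lambda>n. density_on (ball 0 1) (\<lambda>x. (norm (vortex (g n) x))\<^sup>2)) M \<and> 0 < measure M {0}"
          by (rule conc) (simp_all add: C_0_continuous)
        fix \<Lambda> D :: "(real^2) set"
        assume "lattice \<Lambda> \<and> fundamental_domain \<Lambda> D \<and> ball 0 1 \<subseteq> D"
        then have D: "lattice \<Lambda>" "fundamental_domain \<Lambda> D" "ball 0 1 \<subseteq> D" by auto
        show "let U = \<lambda>n. periodize \<Lambda> D (vortex (g n)) in
            (\<forall>n. smooth (U n) \<and> periodic \<Lambda> (U n) \<and> incompressible (U n)) \<and>
            (\<forall>n. Lp_norm 2 D (U n) = 1) \<and>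
            (\<lambda>n. Lp_norm 1 D (U n) + Lp_norm 1 D (curl (U n))) \<longlonglongrightarrow> 0 \<and>
            (\<exists>M. weak_star_conv D (C_torus \<Lambda>) (\<lambda>n. density_on D (\<lambda>x. (norm (U n x))\<^sup>2)) M \<and>
              0 < measure M {0})"
          unfolding Let_def Lp_norm_periodize_vortex[OF D] Lp_norm_curl_periodize_vortex[OF D]
            density_on_periodize_vortex[OF D]
          using periodize_vortex[OF D] L2[OF D(3)] L1[OF D(3)]
            conc[OF fundamental_domain_borel[OF D(2)] D(3), of "C_torus \<Lambda>"] C_torus_continuous by blast
      qed (simp_all only: vortex_n_in_Cc_smooth incompressible_vortex_n L2 L1 order_refl)
    qed
  qed
qed

end
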